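(* For any integers $s\ge 2$ and $n_1\ge n_2>n_3>\cdots>n_s>3$ (that is, $n_1\ge n_2$, $n_i>n_{i+1}$ for $2\le i\le s-1$, and $n_s>3$), one has $\Phi(\mathcal{H}^*_{n_1,\ldots,n_s})=\Phi(\mathcal{H}_{n_1,\ldots,n_s})$ and $R(\mathcal{H}^*_{n_1,\ldots,n_s})=R(\mathcal{H}_{n_1,\ldots,n_s})$.
   Context: For a positive integer $n$, $[n]=\{1,2,\ldots,n\}$, and $[0]=\emptyset$. A bi-hypergraph $\mathcal{H}=(X,\mathcal{B})$ consists of a finite set $X$ of vertices and a family $\mathcal{B}$ of subsets of $X$, called bi-edges; it is 3-uniform if every bi-edge has exactly three elements. For $X'\subseteq X$, the derived sub-hypergraph is $\mathcal{H}[X']=(X',\{B\in\mathcal{B}: B\subseteq X'\})$. A proper $k$-coloring of $\mathcal{H}$ is a map from $X$ into a set of $k$ colors such that each bi-edge contains two vertices with a common color and also contains two vertices with distinct colors. A strict $k$-coloring is a proper $k$-coloring that uses all $k$ colors. The feasible set $\Phi(\mathcal{H})$ is the set of all $k$ such that $\mathcal{H}$ has a strict $k$-coloring; $\overline{\chi}(\mathcal{H})$ is the largest such $k$. For each $k$, $r_k$ denotes the number of partitions of $X$ into $k$ nonempty color classes that arise from strict $k$-colorings of $\mathcal{H}$ (so colorings are counted up to renaming of colors). The chromatic spectrum is $R(\mathcal{H})=(r_1,r_2,\ldots,r_{\overline{\chi}})$. Construction of $\mathcal{H}$: for integers $s\ge 2$ and $n_1\ge n_2\ge\cdots\ge n_s\ge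 3$, let $X_{n_1,\ldots,n_s}=\{(x_1,\ldots,x_s): x_j\in[n_j],\ j\in[s]\}$ and let $\mathcal{B}_{n_1,\ldots,n_s}$ be the family of all sets $\{(x_1,\ldots,x_s),(y_1,\ldots,y_s),(z_1,\ldots,z_s)\}$ of three distinct elements of $X_{n_1,\ldots,n_s}$ such that $|\{x_j,y_j,z_j\}|=2$ for every $j\in[s]$. Then $\mathcal{H}_{n_1,\ldots,n_s}=(X_{n_1,\ldots,n_s},\mathcal{B}_{n_1,\ldots,n_s})$. Construction of $\mathcal{H}^*$: for integers $s\ge 2$ and $n_1\ge n_2>\cdots>n_s>3$, define the following sets of $s$-tuples. $X_1=\{(n_2+j,1,\ldots,1),\ (n_2+j,n_2,n_3,\ldots,n_s) : j\in[n_1-n_2]\}$. For $i=2,\ldots,s-1$, $$X_i=\bigcup_{j=1}^{n_i-n_{i+1}}\{(n_{i+1}+j,1,\ldots,1),\ (n_{i+1}+j,\ldots,n_{i+1}+j,n_{i+1},\ldots,n_s)\}\ \cup\ \bigcup_{j=0}^{n_i-n_{i+1}}\{(1,n_{i+1}+j,\ldots,n_{i+1}+j,1,\ldots,1)\},$$ where in $(n_{i+1}+j,\ldots,n_{i+1}+j,n_{i+1},\ldots,n_s)$ the first $i$ coordinates equal $n_{i+1}+j$ and coordinates $i+1,\ldots,s$ are $n_{i+1},\ldots,n_s$, and in $(1,n_{i+1}+j,\ldots,n_{i+1}+j,1,\ldots,1)$ the value $n_{i+1}+j$ appears $i-1$ times (in coordinates $2,\ldots,i$). $$X_s=\bigcup_{i=1}^{3}\bigcup_{k=1}^{3}\{(i,k,\ldots,k)\}\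 \cup\ \bigcup_{k=4}^{n_s}\{(1,k,\ldots,k),(k,1,\ldots,1),(k,\ldots,k)\}.$$ Let $X^*_{n_1,\ldots,n_s}=\bigcup_{i=1}^s X_i$ and $\mathcal{H}^*_{n_1,\ldots,n_s}=\mathcal{H}_{n_1,\ldots,n_s}[X^*_{n_1,\ldots,n_s}]$. *)

theory Defs
  imports Main "HOL-Library.FuncSet"
begin

record 'a bihypergraph =
  vertices :: "'a set"
  biedges :: "'a set set"

definition derived_sub :: "'a bihypergraph \<Rightarrow> 'a set \<Rightarrow> 'a bihypergraph" where
  "derived_sub H X' = \<lparr>vertices = X', biedges = {B \<in> biedges H. B \<subseteq> X'}\<rparr>"

(* The set of k colors is fixed to be {1..k}. *)
definition proper_coloring :: "'a bihypergraph \<Rightarrow> nat \<Rightarrow> ('a \<Rightarrow> nat) \<Rightarrow> bool" where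
  "proper_coloring H k c \<longleftrightarrow>
     c \<in> vertices H \<rightarrow> {1..k} \<and>
     (\<forall>B\<in>biedges H.
        (\<exists>x\<in>B. \<exists>y\<in>B. x \<noteq> y \<and> c x = c y) \<and>
        (\<exists>x\<in>B. \<exists>y\<in>B. c x \<noteq> c y))"

definition strict_coloring :: "'a bihypergraph \<Rightarrow> nat \<Rightarrow> ('a \<Rightarrow> nat) \<Rightarrow> bool" where
  "strict_coloring H k c \<longleftrightarrow> proper_coloring H k c \<and> c ` vertices H = {1..k}"

definition feasible_set :: "'a bihypergraph \<Rightarrow> nat set" where
  "feasible_set H = {k. \<exists>c. strict_coloring H k c}"

definition upper_chromatic_number :: "'a bihypergraph \<Rightarrow> nat" where
  "upper_chromatic_number H = Max (feasible_set H)"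

definition color_classes :: "'a bihypergraph \<Rightarrow> ('a \<Rightarrow> nat) \<Rightarrow> 'a set set" where
  "color_classes H c = {{y \<in> vertices H. c y = c x} | x. x \<in> vertices H}"

definition num_strict_partitions :: "'a bihypergraph \<Rightarrow> nat \<Rightarrow> nat" where
  "num_strict_partitions H k = card {color_classes H c | c. strict_coloring H k c}"

(* The list [r_1, ..., r_m], where m is the upper chromatic number. *)
definition chromatic_spectrum :: "'a bihypergraph \<Rightarrow> nat list" where
  "chromatic_spectrum H =
     map (num_strict_partitions H) [1..<Suc (upper_chromatic_number H)]"

(* An s-tuple (x_1, ..., x_s) is an extensional function on {1..s}: it is undefined
   outside {1..s}, so equality of functions is equality of tuples.  The sequence
   n_1, ..., n_s is a function n of which only the values on {1..s} matter. *)
type_synonym tuple = "nat \<Rightarrow> nat"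

definition grid_vertices :: "nat \<Rightarrow> (nat \<Rightarrow> nat) \<Rightarrow> tuple set" where
  "grid_vertices s n = (\<Pi>\<^sub>E j\<in>{1..s}. {1..n j})"

definition grid_biedges :: "nat \<Rightarrow> (nat \<Rightarrow> nat) \<Rightarrow> tuple set set" where
  "grid_biedges s n =
     {{x, y, z} | x y z.
        x \<in> grid_vertices s n \<and> y \<in> grid_vertices s n \<and> z \<in> grid_vertices s n \<and>
        x \<noteq> y \<and> y \<noteq> z \<and> x \<noteq> z \<and>
        (\<forall>j\<in>{1..s}. card {x j, y j, z j} = 2)}"

definition grid_hypergraph :: "nat \<Rightarrow> (nat \<Rightarrow> nat) \<Rightarrow> tuple bihypergraph" where
  "grid_hypergraph s n = \<lparr>vertices = grid_vertices s n, biedges = grid_biedges s n\<rparr>"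

(* (a, b, ..., b) *)
definition head_tuple :: "nat \<Rightarrow> nat \<Rightarrow> nat \<Rightarrow> tuple" where
  "head_tuple s a b = (\<lambda>p\<in>{1..s}. if p = 1 then a else b)"

(* (a, ..., a, n_{i+1}, ..., n_s), with a in the coordinates 1, ..., i *)
definition prefix_tuple :: "nat \<Rightarrow> (nat \<Rightarrow> nat) \<Rightarrow> nat \<Rightarrow> nat \<Rightarrow> tuple" where
  "prefix_tuple s n i a = (\<lambda>p\<in>{1..s}. if p \<le> i then a else n p)"

(* (1, a, ..., a, 1, ..., 1), with a in the coordinates 2, ..., i *)
definition middle_tuple :: "nat \<Rightarrow> nat \<Rightarrow> nat \<Rightarrow> tuple" where
  "middle_tuple s i a = (\<lambda>p\<in>{1..s}. if 2 \<le> p \<and> p \<le> i then a else 1)"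

definition X_first :: "nat \<Rightarrow> (nat \<Rightarrow> nat) \<Rightarrow> tuple set" where
  "X_first s n =
     (\<Union>j\<in>{1..n 1 - n 2}. {head_tuple s (n 2 + j) 1, prefix_tuple s n 1 (n 2 + j)})"

definition X_mid :: "nat \<Rightarrow> (nat \<Rightarrow> nat) \<Rightarrow> nat \<Rightarrow> tuple set" where
  "X_mid s n i =
     (\<Union>j\<in>{1..n i - n (i + 1)}.
        {head_tuple s (n (i + 1) + j) 1, prefix_tuple s n i (n (i + 1) + j)}) \<union>
     (\<Union>j\<in>{0..n i - n (i + 1)}. {middle_tuple s i (n (i + 1) + j)})"

definition X_last :: "nat \<Rightarrow> (nat \<Rightarrow> nat) \<Rightarrow> tuple set" where
  "X_last s n =
     (\<Union>i\<in>{1..3}. \<Union>k\<in>{1..3}. {head_tuple s i k}) \<union>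
     (\<Union>k\<in>{4..n s}. {head_tuple s 1 k, head_tuple s k 1, head_tuple s k k})"

definition star_vertices :: "nat \<Rightarrow> (nat \<Rightarrow> nat) \<Rightarrow> tuple set" where
  "star_vertices s n = X_first s n \<union> (\<Union>i\<in>{2..s - 1}. X_mid s n i) \<union> X_last s n"

definition star_hypergraph :: "nat \<Rightarrow> (nat \<Rightarrow> nat) \<Rightarrow> tuple bihypergraph" where
  "star_hypergraph s n = derived_sub (grid_hypergraph s n) (star_vertices s n)"

end

theory Submission
  imports Defs
begin

text \<open>
  Both hypergraphs turn out to have only the obvious colourings: in every proper colouring two vertices
  have the same colour iff they agree in one fixed coordinate \<open>j\<close>. Conversely every
  coordinate is a strict colouring with \<open>n j\<close> colours, and different coordinates give different
  partitions. So in both cases the feasible set is \<open>{n 1, \<dots>, n s}\<close>, and the number of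
  partitions into \<open>k\<close> classes is the number of \<open>j\<close> with \<open>n j = k\<close>
  (locale \<open>coordinate_colored\<close>).

  The common engine is \<open>rectangle_coloring\<close>: if in a rectangle with at least three rows and
  columns any three corners of a \<open>2 \<times> 2\<close> square carry exactly two colours, then the colour
  is an injective function of the row or of the column.

  In the full grid, take a line in direction \<open>j\<close> that is not constant. With two further lines
  in direction \<open>j\<close>, mutually different in all other coordinates, it forms a rectangle,
  so these lines are coloured in the same way. Any two lines have a common opposite
  one, hence the colour depends on coordinate \<open>j\<close> only (\<open>grid_coloring_is_coordinate\<close>).

  The star consists of layers. The innermost layer \<open>s\<close> contains a \<open>3 \<times> 3\<close> rectangle,
  which is coloured by coordinate 1 or by coordinate \<open>s\<close>. On the layers of index above \<open>m\<close> the
  coordinates 2 to \<open>m + 1\<close> coincide. Layer \<open>m\<close> adds axis points \<open>(a, 1, \<dots>, 1)\<close>,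
  prefix tuples \<open>(a, \<dots>, a, n (m + 1), \<dots>, n s)\<close> and middle tuples
  \<open>(1, a, \<dots>, a, 1, \<dots>, 1)\<close>, and a handful of bi-edges forces their colours from those
  inside. The only freedom is at the corner, the middle tuple with \<open>a = n (m + 1)\<close>: if the
  inside is coloured by coordinate \<open>m + 1\<close>, the corner may have colour 1 or colour \<open>n (m + 1)\<close>,
  and the whole layer then follows coordinate \<open>m + 1\<close> or \<open>m\<close>, respectively. After layer 1
  the colouring is given by one coordinate (\<open>tail_coloring\<close>).
\<close>

section \<open>Colourings as maps preserving two-valued triples\<close>

definition two_valued :: "'a \<Rightarrow> 'a \<Rightarrow> 'a \<Rightarrow> bool" where
  "two_valued a b c \<longleftrightarrow> (a = b \<or> b = c \<or> a = c) \<and> \<not> (a = b \<and> b = c)"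

lemma card_eq_2_iff_two_valued: "card {a, b, c} = 2 \<longleftrightarrow> two_valued a b c"
  by (auto simp: two_valued_def card_insert_if)

definition transversal :: "nat \<Rightarrow> tuple \<Rightarrow> tuple \<Rightarrow> tuple \<Rightarrow> bool" where
  "transversal s x y z \<longleftrightarrow>
     x \<noteq> y \<and> y \<noteq> z \<and> x \<noteq> z \<and> (\<forall>j\<in>{1..s}. two_valued (x j) (y j) (z j))"

definition bicolored :: "nat \<Rightarrow> tuple set \<Rightarrow> (tuple \<Rightarrow> nat) \<Rightarrow> bool" where
  "bicolored s V c \<longleftrightarrow>
     (\<forall>x\<in>V. \<forall>y\<in>V. \<forall>z\<in>V. transversal s x y z \<longrightarrow> two_valued (c x) (c y) (c z))"

lemma bicoloredD:
  "bicolored s V c \<Longrightarrow> x \<in> V \<Longrightarrow> y \<in> V \<Longrightarrow> z \<in> V \<Longrightarrow> transversal s x y z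
    \<Longrightarrow> two_valued (c x) (c y) (c z)"
  by (auto simp: bicolored_def)

lemma transversalI:
  assumes "\<And>j. j \<in> {1..s} \<Longrightarrow> two_valued (x j) (y j) (z j)"
    and "x i \<noteq> y i" "y j \<noteq> z j" "x k \<noteq> z k"
  shows "transversal s x y z"
  using assms by (auto simp: transversal_def)

text \<open>
  On three distinct vertices, having a common colour and having two distinct colours together mean
  that exactly two colours occur, which is also the condition imposed on the coordinates of a bi-edge.
  From here on colourings are studied through this symmetric ternary relation only.
\<close>

lemma proper_coloring_derived_iff:
  assumes "V \<subseteq> grid_vertices s n"
  shows "proper_coloring (derived_sub (grid_hypergraph s n) V) k c \<longleftrightarrow>
           c \<in> V \<rightarrow> {1..k} \<and> bicolored s V c"
proof -
  define good where "good B \<longleftrightarrow>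
    (\<exists>x\<in>B. \<exists>y\<in>B. x \<noteq> y \<and> c x = c y) \<and> (\<exists>x\<in>B. \<exists>y\<in>B. c x \<noteq> c y)" for B
  let ?E = "biedges (derived_sub (grid_hypergraph s n) V)"
  have edges: "?E = {{x, y, z} |x y z. x \<in> V \<and> y \<in> V \<and> z \<in> V \<and> transversal s x y z}"
    (is "_ = ?R")
  proof
    show "?E \<subseteq> ?R"
      by (auto simp: derived_sub_def grid_hypergraph_def grid_biedges_def transversal_def
          card_eq_2_iff_two_valued)
    show "?R \<subseteq> ?E"
      using assms
      by (auto simp: derived_sub_def grid_hypergraph_def grid_biedges_def transversal_def
          card_eq_2_iff_two_valued)
  qed
  have "good {x, y, z} \<longleftrightarrow> two_valued (c x) (c y) (c z)" if "transversal s x y z" for x y z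
    using that by (auto simp: good_def transversal_def two_valued_def)
  moreover have "(\<forall>B\<in>?E. good B) \<longleftrightarrow>
      (\<forall>x y z. x \<in> V \<and> y \<in> V \<and> z \<in> V \<and> transversal s x y z \<longrightarrow> good {x, y, z})"
    unfolding edges by blast
  ultimately have "(\<forall>B\<in>?E. good B) \<longleftrightarrow> bicolored s V c"
    unfolding bicolored_def by blast
  then show ?thesis
    unfolding proper_coloring_def good_def by (simp add: derived_sub_def)
qed

section \<open>Colourings of rectangles\<close>

definition rectangle_bicolored :: "'a set \<Rightarrow> 'b set \<Rightarrow> ('a \<Rightarrow> 'b \<Rightarrow> nat) \<Rightarrow> bool" where
  "rectangle_bicolored A B g \<longleftrightarrow>
     (\<forall>a\<in>A. \<forall>a'\<in>A. \<forall>b\<in>B. \<forall>b'\<in>B. a \<noteq> a' \<longrightarrow> b \<noteq> b' \<longrightarrow>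
        two_valued (g a b) (g a b') (g a' b))"

definition three_elements :: "'a set \<Rightarrow> bool" where
  "three_elements A \<longleftrightarrow> (\<forall>p q. \<exists>r\<in>A. r \<noteq> p \<and> r \<noteq> q)"

text \<open>
  In a \<open>2 \<times> 2\<close> square with rows \<open>a\<close>, \<open>a'\<close> and columns \<open>b\<close>, \<open>b'\<close>
  each colour occurs exactly twice, so equal colours form the rows, the columns or the diagonals.
  As \<open>g a b \<noteq> g a b'\<close>, only columns and diagonals remain, and the diagonal
  pattern is the one to exclude. With a third row and a third column it would spread: the nine cells
  would carry two colours only, any two rows being equal or complementary. Two of three rows are then
  equal, and so are two of three columns; they meet in a monochromatic square.
\<close>

lemma no_swap:
  assumes rect: "rectangle_bicolored A B g" and A3: "three_elements A" and B3: "three_elements B"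
    and in_sets: "a \<in> A" "a' \<in> A" "b \<in> B" "b' \<in> B"
    and ne: "g a b \<noteq> g a b'"
  shows "g a' b = g a b"
proof (cases "a' = a")
  case False
  obtain a2 where a2: "a2 \<in> A" "a2 \<noteq> a" "a2 \<noteq> a'" using A3 unfolding three_elements_def by blast
  obtain b2 where b2: "b2 \<in> B" "b2 \<noteq> b" "b2 \<noteq> b'" using B3 unfolding three_elements_def by blast
  have square: "(g p q = g p r \<and> g t q = g t r \<and> g p q \<noteq> g t q) \<or>
      (g p q = g t q \<and> g p r = g t r \<and> g p q \<noteq> g p r) \<or>
      (g p q = g t r \<and> g p r = g t q \<and> g p q \<noteq> g p r)"
    if "p \<in> A" "t \<in> A" "q \<in> B" "r \<in> B" "p \<noteq> t" "q \<noteq> r" for p t q r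
  proof -
    have "two_valued (g p q) (g p r) (g t q)" "two_valued (g t q) (g t r) (g p q)"
      "two_valued (g p r) (g p q) (g t r)" "two_valued (g t r) (g t q) (g p r)"
      using rect that unfolding rectangle_bicolored_def by auto
    then show ?thesis unfolding two_valued_def by metis
  qed
  have "b \<noteq> b'" using ne by auto
  show ?thesis
    using square[of a a' b b'] square[of a a' b b2] square[of a a' b' b2]
      square[of a a2 b b'] square[of a a2 b b2] square[of a a2 b' b2]
      square[of a' a2 b b'] square[of a' a2 b b2] square[of a' a2 b' b2]
      a2 b2 False \<open>b \<noteq> b'\<close> in_sets ne
    by (smt (verit))
qed simp

text \<open>
  If some row is not constant, then by \<open>no_swap\<close> any column is constant: its entry in that row
  differs from the entry of one of two differently coloured columns. Two columns of equal
  colour would give a monochromatic corner, hence the injectivity.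
\<close>

lemma rectangle_coloring:
  assumes rect: "rectangle_bicolored A B g" and A3: "three_elements A" and B3: "three_elements B"
  shows "(\<exists>f. inj_on f A \<and> (\<forall>a\<in>A. \<forall>b\<in>B. g a b = f a)) \<or>
         (\<exists>f. inj_on f B \<and> (\<forall>a\<in>A. \<forall>b\<in>B. g a b = f b))"
proof (cases "\<exists>a\<in>A. \<exists>b\<in>B. \<exists>b'\<in>B. g a b \<noteq> g a b'")
  case True
  then obtain a b0 b1 where w: "a \<in> A" "b0 \<in> B" "b1 \<in> B" "g a b0 \<noteq> g a b1" by blast
  have eq: "g a' b = g a b" if "a' \<in> A" "b \<in> B" for a' b
  proof -
    obtain b' where "b' \<in> B" "g a b \<noteq> g a b'" using w by metis
    then show ?thesis
      using no_swap[OF rect A3 B3] that w by blast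
  qed
  have "inj_on (g a) B"
  proof (rule inj_onI, rule ccontr)
    fix b b' assume b: "b \<in> B" "b' \<in> B" "g a b = g a b'" "b \<noteq> b'"
    obtain a' where "a' \<in> A" "a' \<noteq> a" using A3 unfolding three_elements_def by blast
    then have "two_valued (g a b) (g a b') (g a' b)"
      using rect b w unfolding rectangle_bicolored_def by metis
    then show False using eq[OF \<open>a' \<in> A\<close> b(1)] b by (simp add: two_valued_def)
  qed
  then show ?thesis using eq by blast
next
  case False
  obtain b where b: "b \<in> B" using B3 unfolding three_elements_def by blast
  obtain b' where b': "b' \<in> B" "b' \<noteq> b" using B3 unfolding three_elements_def by blast
  have eq: "g a y = g a b" if "a \<in> A" "y \<in> B" for a y
    using False that b by blast
  have "inj_on (\<lambda>a. g a b) A"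
  proof (rule inj_onI, rule ccontr)
    fix a a' assume a: "a \<in> A" "a' \<in> A" "g a b = g a' b" "a \<noteq> a'"
    then have "two_valued (g a b) (g a b') (g a' b)"
      using rect b b' unfolding rectangle_bicolored_def by metis
    then show False using eq[OF a(1) b'(1)] a by (simp add: two_valued_def)
  qed
  then show ?thesis using eq by (intro disjI1 exI[of _ "\<lambda>a. g a b"]) auto
qed

section \<open>Colourings of the full grid\<close>

lemma three_elements_interval:
  assumes "3 \<le> (k::nat)"
  shows "three_elements {1..k}"
  unfolding three_elements_def
proof (intro allI)
  fix p q :: nat
  have "(1 \<noteq> p \<and> 1 \<noteq> q) \<or> (2 \<noteq> p \<and> 2 \<noteq> q) \<or> (3 \<noteq> p \<and> 3 \<noteq> q)" by linarith
  moreover have "1 \<in> {1..k}" "2 \<in> {1..k}" "3 \<in> {1..k}" using assms by auto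
  ultimately show "\<exists>r\<in>{1..k}. r \<noteq> p \<and> r \<noteq> q" by blast
qed

lemma grid_update:
  "x \<in> grid_vertices s n \<Longrightarrow> j \<in> {1..s} \<Longrightarrow> b \<in> {1..n j} \<Longrightarrow> x(j := b) \<in> grid_vertices s n"
  unfolding grid_vertices_def by (auto simp: PiE_iff extensional_def)

lemma common_opposite:
  assumes "\<And>i. i \<in> {1..s} \<Longrightarrow> n i \<ge> 3"
  obtains z where "z \<in> grid_vertices s n" "\<And>i. i \<in> {1..s} \<Longrightarrow> z i \<noteq> x i \<and> z i \<noteq> y i"
proof -
  have "\<forall>i\<in>{1..s}. \<exists>r\<in>{1..n i}. r \<noteq> x i \<and> r \<noteq> y i"
    using three_elements_interval assms unfolding three_elements_def by blast
  then obtain z where z: "\<forall>i\<in>{1..s}. z i \<in> {1..n i} \<and> z i \<noteq> x i \<and> z i \<noteq> y i" by metis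
  show ?thesis
    by (rule that[of "restrict z {1..s}"]) (use z in \<open>auto simp: grid_vertices_def\<close>)
qed

text \<open>
  The transport step for the full grid. The lines through \<open>x\<close>, \<open>y\<close> and a third
  point \<open>z\<close> in direction \<open>j\<close>, pairwise different in every other coordinate, form a
  rectangle in the sense of \<open>rectangle_bicolored\<close>: any corner of it is a bi-edge. If the
  line through \<open>x\<close> is not constant, the colour on all three lines depends on the
  coordinate \<open>j\<close> only.
\<close>

lemma opposite_lines:
  assumes c: "bicolored s (grid_vertices s n) c" and "s \<ge> 2"
    and n3: "\<And>i. i \<in> {1..s} \<Longrightarrow> n i \<ge> 3"
    and x: "x \<in> grid_vertices s n" and y: "y \<in> grid_vertices s n"
    and j: "j \<in> {1..s}" and opp: "\<And>i. i \<in> {1..s} \<Longrightarrow> i \<noteq> j \<Longrightarrow> x i \<noteq> y i"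
    and b: "b0 \<in> {1..n j}" "b1 \<in> {1..n j}" "c (x(j := b0)) \<noteq> c (x(j := b1))"
  shows "inj_on (\<lambda>b. c (x(j := b))) {1..n j}"
    and "\<And>b. b \<in> {1..n j} \<Longrightarrow> c (y(j := b)) = c (x(j := b))"
proof -
  obtain z where z: "z \<in> grid_vertices s n" "\<And>i. i \<in> {1..s} \<Longrightarrow> z i \<noteq> x i \<and> z i \<noteq> y i"
    using common_opposite n3 by metis
  \<comment> \<open>A second direction is needed to tell the three lines apart.\<close>
  obtain i0 where i0: "i0 \<in> {1..s}" "i0 \<noteq> j"
    using \<open>s \<ge> 2\<close> by (cases "j = 1") (auto intro: that[of 1] that[of 2])
  have distinct: "x \<noteq> y" "z \<noteq> x" "z \<noteq> y" using z(2)[OF i0(1)] opp[OF i0] by auto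
  have rect: "rectangle_bicolored {x, y, z} {1..n j} (\<lambda>t b. c (t(j := b)))"
    unfolding rectangle_bicolored_def
  proof (intro ballI impI)
    fix t t' b b'
    assume t: "t \<in> {x, y, z}" "t' \<in> {x, y, z}" "b \<in> {1..n j}" "b' \<in> {1..n j}" "t \<noteq> t'" "b \<noteq> b'"
    have ne: "t i \<noteq> t' i" if "i \<in> {1..s}" "i \<noteq> j" for i
      using t(1,2,5) opp[OF that] z(2)[OF that(1)] by auto
    have "transversal s (t(j := b)) (t(j := b')) (t'(j := b))"
      by (rule transversalI[where i = j and j = j and k = i0])
        (use ne i0 t in \<open>auto simp: two_valued_def\<close>)
    then show "two_valued (c (t(j := b))) (c (t(j := b'))) (c (t'(j := b)))"
      by (rule bicoloredD[OF c, rotated -1]) (use t x y z(1) j grid_update in auto)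
  qed
  have A3: "three_elements {x, y, z}" using distinct unfolding three_elements_def by auto
  have B3: "three_elements {1..n j}" by (rule three_elements_interval) (rule n3[OF j])
  have no_rows: "\<nexists>f. inj_on f {x, y, z} \<and> (\<forall>t\<in>{x, y, z}. \<forall>b\<in>{1..n j}. c (t(j := b)) = f t)"
    using b by auto
  from rectangle_coloring[OF rect A3 B3]
  have "\<exists>f. inj_on f {1..n j} \<and> (\<forall>t\<in>{x, y, z}. \<forall>b\<in>{1..n j}. c (t(j := b)) = f b)"
    by (rule disjE) (erule notE[OF no_rows], assumption)
  then obtain f where f: "inj_on f {1..n j}"
    and "\<forall>t\<in>{x, y, z}. \<forall>b\<in>{1..n j}. c (t(j := b)) = f b"
    by (elim exE conjE)
  then have eq: "\<And>b. b \<in> {1..n j} \<Longrightarrow> c (x(j := b)) = f b \<and> c (y(j := b)) = f b"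
    by simp
  then have "inj_on (\<lambda>b. c (x(j := b))) {1..n j} = inj_on f {1..n j}"
    by (intro inj_on_cong) simp
  with f eq show "inj_on (\<lambda>b. c (x(j := b))) {1..n j}"
    and "\<And>b. b \<in> {1..n j} \<Longrightarrow> c (y(j := b)) = c (x(j := b))"
    by simp_all
qed

text \<open>
  If changing one coordinate never changed the colour, then changing them one after another
  would make the colouring constant, although there is a bi-edge.
\<close>

lemma grid_bicolored_line:
  assumes c: "bicolored s (grid_vertices s n) c" and "s \<ge> 2"
    and n3: "\<And>i. i \<in> {1..s} \<Longrightarrow> n i \<ge> 3"
  shows "\<exists>x\<in>grid_vertices s n. \<exists>j\<in>{1..s}. \<exists>b\<in>{1..n j}. c (x(j := b)) \<noteq> c x"
proof (rule ccontr)
  assume uniform: "\<not> ?thesis"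
  then have const: "c (x(j := b)) = c x"
    if "x \<in> grid_vertices s n" "j \<in> {1..s}" "b \<in> {1..n j}" for x j b
    using that uniform by blast
  have eq: "c q = c p" if p: "p \<in> grid_vertices s n" and q: "q \<in> grid_vertices s n" for p q
  proof -
    \<comment> \<open>The coordinates up to \<open>k\<close> are already those of \<open>q\<close>.\<close>
    let ?w = "\<lambda>k i. if i \<le> k then q i else p i"
    have ext: "p 0 = q 0" "\<And>i. i > s \<Longrightarrow> p i = q i"
      using p q by (auto simp: grid_vertices_def PiE_iff extensional_def)
    have "?w k \<in> grid_vertices s n \<and> c (?w k) = c p" if "k \<le> s" for k
      using that
    proof (induction k)
      case 0
      have "?w 0 = p" using ext by auto
      then show ?case using p by simp
    next
      case (Suc k)
      have "?w (Suc k) = (?w k)(Suc k := q (Suc k))" by (auto simp: fun_eq_iff le_Suc_eq)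
      moreover have "q (Suc k) \<in> {1..n (Suc k)}" "Suc k \<in> {1..s}"
        using q Suc.prems by (auto simp: grid_vertices_def PiE_iff)
      moreover have "?w k \<in> grid_vertices s n" "c (?w k) = c p" using Suc by auto
      ultimately show ?case using const grid_update by simp
    qed
    from this[of s] have "c (?w s) = c p" by simp
    moreover have "?w s = q" using ext by (auto simp: fun_eq_iff)
    ultimately show ?thesis by simp
  qed
  let ?t = "head_tuple s"
  have grid: "?t a b \<in> grid_vertices s n" if "a \<in> {1, 2}" "b \<in> {1, 2}" for a b
    using that n3 by (force simp: head_tuple_def grid_vertices_def)
  have "transversal s (?t 1 1) (?t 1 2) (?t 2 1)"
    by (rule transversalI[where i = 2 and j = 1 and k = 1])
      (use \<open>s \<ge> 2\<close> in \<open>auto simp: head_tuple_def two_valued_def\<close>)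
  then have "two_valued (c (?t 1 1)) (c (?t 1 2)) (c (?t 2 1))"
    by (intro bicoloredD[OF c]) (auto intro!: grid simp del: One_nat_def)
  then show False
    using eq[OF grid grid] unfolding two_valued_def by (metis insertCI)
qed

text \<open>
  A line in direction \<open>j\<close> with two colours transports to every other parallel line: two
  parallel lines always have a common opposite one, because every coordinate has three values.
\<close>

lemma grid_coloring_is_coordinate:
  assumes c: "bicolored s (grid_vertices s n) c" and s: "s \<ge> 2"
    and n3: "\<And>i. i \<in> {1..s} \<Longrightarrow> n i \<ge> 3"
  shows "\<exists>j\<in>{1..s}. \<forall>x\<in>grid_vertices s n. \<forall>y\<in>grid_vertices s n. c x = c y \<longleftrightarrow> x j = y j"
proof -
  obtain x j b where x: "x \<in> grid_vertices s n" and j: "j \<in> {1..s}"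
    and b: "b \<in> {1..n j}" "c (x(j := b)) \<noteq> c x"
    using grid_bicolored_line[OF c s n3] by metis
  have xj: "x j \<in> {1..n j}" "c (x(j := b)) \<noteq> c (x(j := x j))"
    using x j b by (auto simp: grid_vertices_def PiE_iff)
  have lines: "inj_on (\<lambda>b. c (x(j := b))) {1..n j} \<and> (\<forall>b\<in>{1..n j}. c (y(j := b)) = c (x(j := b)))"
    if y: "y \<in> grid_vertices s n" for y
  proof -
    obtain w where w: "w \<in> grid_vertices s n" "\<And>i. i \<in> {1..s} \<Longrightarrow> w i \<noteq> x i \<and> w i \<noteq> y i"
      using common_opposite n3 by metis
    have inj: "inj_on (\<lambda>b. c (x(j := b))) {1..n j}"
      and wx: "\<And>b. b \<in> {1..n j} \<Longrightarrow> c (w(j := b)) = c (x(j := b))"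
      using opposite_lines[OF c s n3 x w(1) j _ b(1) xj] w(2) by metis+
    have "c (w(j := b)) \<noteq> c (w(j := x j))" using wx b xj by auto
    then have "\<And>b. b \<in> {1..n j} \<Longrightarrow> c (y(j := b)) = c (w(j := b))"
      using opposite_lines(2)[OF c s n3 w(1) y j _ b(1) xj(1)] w(2) by metis
    then show ?thesis using inj wx by auto
  qed
  have col: "c y = c (x(j := y j)) \<and> y j \<in> {1..n j}" if y: "y \<in> grid_vertices s n" for y
  proof -
    have "y j \<in> {1..n j}" using y j by (auto simp: grid_vertices_def PiE_iff)
    then show ?thesis using lines[OF y] by (metis fun_upd_triv)
  qed
  have "c y = c z \<longleftrightarrow> y j = z j" if "y \<in> grid_vertices s n" "z \<in> grid_vertices s n" for y z
    using col[OF that(1)] col[OF that(2)] lines[OF x] by (metis inj_onD)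
  then show ?thesis using j by blast
qed

section \<open>Spectra determined by coordinate colourings\<close>

text \<open>
  Used to see that a strict \<open>k\<close>-colouring with the kernel of coordinate \<open>j\<close> has
  \<open>k = n j\<close>.
\<close>

lemma card_image_eq_if_same_kernel:
  assumes "\<And>x y. x \<in> V \<Longrightarrow> y \<in> V \<Longrightarrow> f x = f y \<longleftrightarrow> g x = g y"
  shows "card (f ` V) = card (g ` V)"
proof -
  let ?S = "(\<lambda>x. (f x, g x)) ` V"
  have "inj_on fst ?S" "inj_on snd ?S" using assms by (auto simp: inj_on_def)
  moreover have "fst ` ?S = f ` V" "snd ` ?S = g ` V" by force+
  ultimately show ?thesis by (metis card_image)
qed

text \<open>
  What the grid and the star share, and all that feasible set and spectrum depend on: every
  colouring has the kernel of a coordinate, coordinate \<open>j\<close> takes each of its \<open>n j\<close>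
  values, and two coordinates never induce the same partition. Hence the partition numbers depend on
  \<open>n\<close> alone, not on \<open>V\<close>.
\<close>

locale coordinate_colored =
  fixes s :: nat and n :: "nat \<Rightarrow> nat" and V :: "tuple set"
  assumes subset_grid: "V \<subseteq> grid_vertices s n"
    and only_coordinates: "\<And>c. bicolored s V c \<Longrightarrow>
          \<exists>j\<in>{1..s}. \<forall>x\<in>V. \<forall>y\<in>V. c x = c y \<longleftrightarrow> x j = y j"
    and all_values: "\<And>j. j \<in> {1..s} \<Longrightarrow> (\<lambda>x. x j) ` V = {1..n j}"
    and separated: "\<And>i j. i \<in> {1..s} \<Longrightarrow> j \<in> {1..s} \<Longrightarrow> i < j \<Longrightarrow>
          \<exists>x\<in>V. \<exists>y\<in>V. x i = y i \<and> x j \<noteq> y j"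
begin

abbreviation "H \<equiv> derived_sub (grid_hypergraph s n) V"

lemma vertices_H: "vertices H = V"
  by (simp add: derived_sub_def)

definition coordinate_classes :: "nat \<Rightarrow> tuple set set" where
  "coordinate_classes j = color_classes H (\<lambda>x. x j)"

lemma coordinate_strict:
  assumes j: "j \<in> {1..s}"
  shows "strict_coloring H (n j) (\<lambda>x. x j)"
proof -
  have "bicolored s V (\<lambda>x. x j)" using j by (auto simp: bicolored_def transversal_def)
  then show ?thesis
    using all_values[OF j]
    by (auto simp: strict_coloring_def proper_coloring_derived_iff[OF subset_grid] vertices_H)
qed

lemma strict_is_coordinate:
  assumes "strict_coloring H k c"
  shows "\<exists>j\<in>{1..s}. n j = k \<and> color_classes H c = coordinate_classes j"
proof -
  have bi: "bicolored s V c" and im: "c ` V = {1..k}"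
    using assms
    by (auto simp: strict_coloring_def proper_coloring_derived_iff[OF subset_grid] vertices_H)
  from only_coordinates[OF bi] obtain j where j: "j \<in> {1..s}" and
    "\<forall>x\<in>V. \<forall>y\<in>V. c x = c y \<longleftrightarrow> x j = y j" ..
  then have eq: "\<And>x y. x \<in> V \<Longrightarrow> y \<in> V \<Longrightarrow> c x = c y \<longleftrightarrow> x j = y j"
    by blast
  have "card (c ` V) = card ((\<lambda>x. x j) ` V)"
    by (rule card_image_eq_if_same_kernel) (rule eq)
  then have "n j = k" using im all_values[OF j] by simp
  moreover have "color_classes H c = coordinate_classes j"
  proof -
    have "{y \<in> V. c y = c x} = {y \<in> V. y j = x j}" if "x \<in> V" for x using eq that by blast
    then have "(\<lambda>x. {y \<in> V. c y = c x}) ` V = (\<lambda>x. {y \<in> V. y j = x j}) ` V"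
      by (rule image_cong[OF refl])
    then show ?thesis
      unfolding color_classes_def coordinate_classes_def vertices_H Setcompr_eq_image by simp
  qed
  ultimately show ?thesis using j by blast
qed

lemma feasible: "feasible_set H = n ` {1..s}"
  unfolding feasible_set_def using coordinate_strict strict_is_coordinate by blast

lemma coordinate_classes_inj: "inj_on coordinate_classes {1..s}"
proof (rule linorder_inj_onI)
  fix i j assume ij: "i < j" "i \<in> {1..s}" "j \<in> {1..s}"
  then obtain x y where xy: "x \<in> V" "y \<in> V" "x i = y i" "x j \<noteq> y j"
    using separated by blast
  have "{z \<in> V. z i = x i} \<in> coordinate_classes i"
    using xy by (auto simp: coordinate_classes_def color_classes_def vertices_H)
  moreover have "{z \<in> V. z i = x i} \<notin> coordinate_classes j"
    using xy by (auto simp: coordinate_classes_def color_classes_def vertices_H set_eq_iff) metis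
  ultimately show "coordinate_classes i \<noteq> coordinate_classes j" by metis
qed auto

lemma partitions: "num_strict_partitions H k = card {j \<in> {1..s}. n j = k}"
proof -
  have "{color_classes H c |c. strict_coloring H k c} = coordinate_classes ` {j \<in> {1..s}. n j = k}"
  proof
    show "{color_classes H c |c. strict_coloring H k c} \<subseteq> coordinate_classes ` {j \<in> {1..s}. n j = k}"
      using strict_is_coordinate by blast
    show "coordinate_classes ` {j \<in> {1..s}. n j = k} \<subseteq> {color_classes H c |c. strict_coloring H k c}"
      using coordinate_strict by (auto simp: coordinate_classes_def)
  qed
  moreover have "inj_on coordinate_classes {j \<in> {1..s}. n j = k}"
    by (rule inj_on_subset[OF coordinate_classes_inj]) auto
  ultimately show ?thesis by (simp add: num_strict_partitions_def card_image)
qed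

end

lemma same_spectrum:
  assumes "coordinate_colored s n V" "coordinate_colored s n W"
  shows "feasible_set (derived_sub (grid_hypergraph s n) V)
       = feasible_set (derived_sub (grid_hypergraph s n) W)"
    and "chromatic_spectrum (derived_sub (grid_hypergraph s n) V)
       = chromatic_spectrum (derived_sub (grid_hypergraph s n) W)"
  using coordinate_colored.feasible[OF assms(1)] coordinate_colored.feasible[OF assms(2)]
    coordinate_colored.partitions[OF assms(1)] coordinate_colored.partitions[OF assms(2)]
  by (simp_all add: chromatic_spectrum_def upper_chromatic_number_def)

lemma derived_sub_grid: "derived_sub (grid_hypergraph s n) (grid_vertices s n) = grid_hypergraph s n"
  by (auto simp: derived_sub_def grid_hypergraph_def grid_biedges_def)

section \<open>The vertices of the star\<close>

locale star_params =
  fixes s :: nat and n :: "nat \<Rightarrow> nat"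
  assumes s_ge_2: "s \<ge> 2" and n_1_2: "n 1 \<ge> n 2"
    and n_step: "\<And>i. 2 \<le> i \<Longrightarrow> i \<le> s - 1 \<Longrightarrow> n i > n (i + 1)"
    and n_s: "n s > 3"
begin

lemma n_strict: "2 \<le> i \<Longrightarrow> i < j \<Longrightarrow> j \<le> s \<Longrightarrow> n j < n i"
proof (induction j)
  case (Suc j)
  then have "n (Suc j) < n j" using n_step[of j] by simp
  then show ?case using Suc by (cases "i = j") auto
qed simp

lemma n_mono: "1 \<le> i \<Longrightarrow> i \<le> j \<Longrightarrow> j \<le> s \<Longrightarrow> n j \<le> n i"
proof (cases "i = 1")
  case True
  assume "i \<le> j" "j \<le> s"
  then show ?thesis
    using True n_1_2 n_strict[of 2 j] by (cases "j = 1"; cases "j = 2") auto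
next
  case False
  assume "1 \<le> i" "i \<le> j" "j \<le> s"
  then show ?thesis using False n_strict[of i j] by (cases "i = j") auto
qed

lemma n_gt_3: "1 \<le> i \<Longrightarrow> i \<le> s \<Longrightarrow> 3 < n i"
  using n_mono[of i s] n_s by simp

text \<open>
  The smallest value of a point of layer \<open>i\<close>. For \<open>i < s\<close> the value
  \<open>n (i + 1)\<close> is included: there the prefix tuple of layer \<open>i\<close> coincides with one of
  layer \<open>i + 1\<close>, while, for \<open>i \<ge> 2\<close>, the middle tuple is a new vertex, the corner
  whose colour decides how the layer is coloured.
\<close>

definition lower :: "nat \<Rightarrow> nat" where
  "lower i = (if i = s then 1 else n (i + 1))"

lemma lower_pos: "1 \<le> i \<Longrightarrow> i \<le> s \<Longrightarrow> 1 \<le> lower i"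
  using n_gt_3[of "i + 1"] by (auto simp: lower_def)

lemma lower_le: "1 \<le> i \<Longrightarrow> i \<le> s \<Longrightarrow> lower i \<le> n i"
  using n_mono[of i "i + 1"] n_gt_3[of i] by (auto simp: lower_def)

lemma level_exists:
  "1 \<le> m \<Longrightarrow> m \<le> s \<Longrightarrow> 1 \<le> k \<Longrightarrow> k \<le> n m \<Longrightarrow>
     \<exists>q. m \<le> q \<and> q \<le> s \<and> lower q \<le> k \<and> k \<le> n q \<and> (q = s \<or> n (q + 1) < k)"
proof (induction "s - m" arbitrary: m)
  case 0
  then have "m = s" by simp
  then show ?case using 0 by (intro exI[of _ s]) (auto simp: lower_def)
next
  case (Suc d)
  show ?case
  proof (cases "k \<le> n (m + 1)")
    case True
    obtain q where "m + 1 \<le> q" "q \<le> s \<and> lower q \<le> k \<and> k \<le> n q \<and> (q = s \<or> n (q + 1) < k)"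
    proof -
      have "d = s - (m + 1)" "1 \<le> m + 1" "m + 1 \<le> s" using Suc.hyps(2) by auto
      then show ?thesis using Suc.hyps(1)[of "m + 1"] Suc.prems(3) True that by blast
    qed
    then show ?thesis by (intro exI[of _ q]) simp
  next
    case False
    then show ?thesis using Suc.hyps(2) Suc.prems by (intro exI[of _ m]) (auto simp: lower_def)
  qed
qed

abbreviation first_axis :: "nat \<Rightarrow> tuple" where
  "first_axis a \<equiv> head_tuple s a 1"

abbreviation prefix :: "nat \<Rightarrow> nat \<Rightarrow> tuple" where
  "prefix i a \<equiv> prefix_tuple s n i a"

abbreviation middle :: "nat \<Rightarrow> nat \<Rightarrow> tuple" where
  "middle i a \<equiv> middle_tuple s i a"

abbreviation ones :: tuple where
  "ones \<equiv> head_tuple s 1 1"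

lemmas tuple_defs = head_tuple_def prefix_tuple_def middle_tuple_def

lemma prefix_s: "prefix s a = head_tuple s a a"
  by (auto simp: tuple_defs)

lemma middle_s: "middle s a = head_tuple s 1 a"
  by (auto simp: tuple_defs intro!: restrict_ext)

lemma middle_1: "middle 1 a = ones"
  by (auto simp: tuple_defs intro!: restrict_ext)

lemma prefix_next: "prefix i (n (Suc i)) = prefix (Suc i) (n (Suc i))"
  by (auto simp: tuple_defs le_Suc_eq intro!: restrict_ext)

definition block :: "tuple set" where
  "block = {head_tuple s u v |u v. u \<in> {1..3} \<and> v \<in> {1..3}}"

text \<open>
  The layers \<open>m\<close> to \<open>s\<close> of the star, the innermost layer being \<open>s\<close>. The axis
  points are given the range up to \<open>n m\<close> and the last layer is described in terms of prefix
  and middle tuples, so that all layers have the same shape. Middle tuples start at layer 2, since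
  \<open>middle 1 a\<close> is just the all-ones tuple. On \<open>tail m\<close> the
  coordinates 2 to \<open>m\<close> coincide, which is why the induction below can only
  distinguish coordinate 1 and the coordinates from \<open>m\<close> on.
\<close>

definition tail :: "nat \<Rightarrow> tuple set" where
  "tail m = block \<union> {first_axis a |a. a \<in> {1..n m}} \<union>
     {prefix i a |i a. i \<in> {m..s} \<and> a \<in> {lower i..n i}} \<union>
     {middle i a |i a. i \<in> {max 2 m..s} \<and> a \<in> {lower i..n i}}"

lemma tail_memI:
  "u \<in> {1..3} \<Longrightarrow> v \<in> {1..3} \<Longrightarrow> head_tuple s u v \<in> tail m"
  "a \<in> {1..n m} \<Longrightarrow> first_axis a \<in> tail m"
  "i \<in> {m..s} \<Longrightarrow> a \<in> {lower i..n i} \<Longrightarrow> prefix i a \<in> tail m"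
  "i \<in> {max 2 m..s} \<Longrightarrow> a \<in> {lower i..n i} \<Longrightarrow> middle i a \<in> tail m"
  unfolding tail_def block_def by blast+

lemma star_subset_tail: "star_vertices s n \<subseteq> tail 1"
proof
  fix x assume "x \<in> star_vertices s n"
  then consider
      j where "j \<in> {1..n 1 - n 2}" "x = first_axis (n 2 + j) \<or> x = prefix 1 (n 2 + j)"
    | i j where "i \<in> {2..s - 1}" "j \<in> {1..n i - n (i + 1)}"
        "x = first_axis (n (i + 1) + j) \<or> x = prefix i (n (i + 1) + j)"
    | i j where "i \<in> {2..s - 1}" "j \<in> {0..n i - n (i + 1)}" "x = middle i (n (i + 1) + j)"
    | i k where "i \<in> {1..3}" "k \<in> {1..3}" "x = head_tuple s i k"
    | k where "k \<in> {4..n s}" "x = middle s k \<or> x = first_axis k \<or> x = prefix s k"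
    unfolding star_vertices_def X_first_def X_mid_def X_last_def middle_s prefix_s by blast
  then show "x \<in> tail 1"
  proof cases
    case 1
    then show ?thesis
      using s_ge_2 tail_memI(2)[of "n 2 + j" 1] tail_memI(3)[of 1 1 "n 2 + j"]
      by (auto simp: lower_def numeral_2_eq_2)
  next
    case 2
    then have "n i \<le> n 1" "i \<noteq> s" using n_mono[of 1 i] s_ge_2 by auto
    then show ?thesis
      using 2 tail_memI(2)[of "n (i + 1) + j" 1] tail_memI(3)[of i 1 "n (i + 1) + j"]
      by (auto simp: lower_def split: if_splits)
  next
    case 3
    then have "n (i + 1) < n i" "i \<noteq> s" using n_step[of i] s_ge_2 by auto
    then show ?thesis
      using 3 tail_memI(4)[of i 1 "n (i + 1) + j"] by (auto simp: lower_def)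
  next
    case 4
    then show ?thesis using tail_memI(1) by simp
  next
    case 5
    moreover have "n s \<le> n 1" using n_mono[of 1 s] s_ge_2 by auto
    ultimately show ?thesis
      using s_ge_2 tail_memI(2)[of k 1] tail_memI(3)[of s 1 k] tail_memI(4)[of s 1 k]
      by (auto simp: lower_def)
  qed
qed

lemma X_last_memI:
  "u \<in> {1..3} \<Longrightarrow> v \<in> {1..3} \<Longrightarrow> head_tuple s u v \<in> star_vertices s n"
  "k \<in> {1..n s} \<Longrightarrow> head_tuple s 1 k \<in> star_vertices s n"
  "k \<in> {1..n s} \<Longrightarrow> head_tuple s k 1 \<in> star_vertices s n"
  "k \<in> {1..n s} \<Longrightarrow> head_tuple s k k \<in> star_vertices s n"
proof -
  show *: "head_tuple s u v \<in> star_vertices s n" if "u \<in> {1..3}" "v \<in> {1..3}" for u v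
    using that unfolding star_vertices_def X_last_def by blast
  have "head_tuple s 1 k \<in> star_vertices s n \<and> head_tuple s k 1 \<in> star_vertices s n \<and>
      head_tuple s k k \<in> star_vertices s n" if "k \<in> {1..n s}"
  proof (cases "k \<le> 3")
    case True
    then show ?thesis using *[of 1 k] *[of k 1] *[of k k] that by simp
  next
    case False
    then have "k \<in> {4..n s}" using that by auto
    then show ?thesis unfolding star_vertices_def X_last_def by blast
  qed
  then show "k \<in> {1..n s} \<Longrightarrow> head_tuple s 1 k \<in> star_vertices s n"
    "k \<in> {1..n s} \<Longrightarrow> head_tuple s k 1 \<in> star_vertices s n"
    "k \<in> {1..n s} \<Longrightarrow> head_tuple s k k \<in> star_vertices s n" by blast+
qed

lemma between_levels_memI:
  assumes "1 \<le> i" "i < s" "n (i + 1) < a" "a \<le> n i"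
  shows "first_axis a \<in> star_vertices s n" "prefix i a \<in> star_vertices s n"
proof -
  have "first_axis a \<in> star_vertices s n \<and> prefix i a \<in> star_vertices s n"
  proof (cases "i = 1")
    case True
    then have "n 2 < a" "a \<le> n 1" using assms by (auto simp: numeral_2_eq_2)
    then obtain j where "j \<in> {1..n 1 - n 2}" "a = n 2 + j"
      using that[of "a - n 2"] by auto
    then have "first_axis a \<in> X_first s n \<and> prefix 1 a \<in> X_first s n"
      unfolding X_first_def by blast
    then show ?thesis using True unfolding star_vertices_def by blast
  next
    case False
    obtain j where "j \<in> {1..n i - n (i + 1)}" "a = n (i + 1) + j"
      by (rule that[of "a - n (i + 1)"]) (use assms in auto)
    then have "first_axis a \<in> X_mid s n i \<and> prefix i a \<in> X_mid s n i"
      unfolding X_mid_def by blast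
    moreover have "i \<in> {2..s - 1}" using assms False by auto
    ultimately show ?thesis unfolding star_vertices_def by blast
  qed
  then show "first_axis a \<in> star_vertices s n" "prefix i a \<in> star_vertices s n" by auto
qed

lemma first_axis_in:
  assumes "a \<in> {1..n 1}"
  shows "first_axis a \<in> star_vertices s n"
proof -
  obtain q where q: "1 \<le> q" "q \<le> s" "a \<le> n q" "q = s \<or> n (q + 1) < a"
    using level_exists[of 1 a] assms s_ge_2 by auto
  then show ?thesis
    using X_last_memI(3)[of a] between_levels_memI(1)[of q a] assms by (cases "q = s") auto
qed

lemma prefix_in:
  assumes "1 \<le> i" "i \<le> s" "a \<in> {lower i..n i}"
  shows "prefix i a \<in> star_vertices s n"
proof (cases "i = s")
  case True
  then show ?thesis using assms X_last_memI(4)[of a] by (auto simp: prefix_s lower_def)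
next
  case i: False
  show ?thesis
  proof (cases "a = n (i + 1)")
    case True
    then have eq: "prefix i a = prefix (i + 1) a" using prefix_next by simp
    show ?thesis
    proof (cases "i + 1 = s")
      case True
      then show ?thesis using eq \<open>a = _\<close> X_last_memI(4)[of a] n_s by (auto simp: prefix_s)
    next
      case False
      then show ?thesis
        using eq \<open>a = _\<close> between_levels_memI(2)[of "i + 1" a] n_step[of "i + 1"] assms i by auto
    qed
  next
    case False
    then show ?thesis using between_levels_memI(2)[of i a] assms i by (auto simp: lower_def)
  qed
qed

lemma middle_in:
  assumes "1 \<le> i" "i \<le> s" "a \<in> {lower i..n i}"
  shows "middle i a \<in> star_vertices s n"
proof -
  consider "i = 1" | "i = s" | "i \<in> {2..s - 1}" using assms by fastforce
  then show ?thesis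
  proof cases
    case 1
    then show ?thesis using X_last_memI(1)[of 1 1] by (simp add: middle_1 del: One_nat_def)
  next
    case 2
    then show ?thesis using X_last_memI(2)[of a] assms by (auto simp: middle_s lower_def)
  next
    case 3
    then have "i \<noteq> s" by auto
    then obtain j where "j \<in> {0..n i - n (i + 1)}" "a = n (i + 1) + j"
      using assms that[of "a - n (i + 1)"] by (auto simp: lower_def)
    then have "middle i a \<in> X_mid s n i" unfolding X_mid_def by blast
    then show ?thesis using 3 unfolding star_vertices_def by blast
  qed
qed

lemma star_eq_tail: "star_vertices s n = tail 1"
proof
  show "tail 1 \<subseteq> star_vertices s n"
    unfolding tail_def block_def
    using X_last_memI(1) first_axis_in prefix_in middle_in by (fastforce simp del: One_nat_def)
qed (rule star_subset_tail)

lemma star_subset_grid: "star_vertices s n \<subseteq> grid_vertices s n"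
proof
  fix x assume "x \<in> star_vertices s n"
  then consider
      u v where "u \<in> {1..3}" "v \<in> {1..3}" "x = head_tuple s u v"
    | a where "a \<in> {1..n 1}" "x = first_axis a"
    | i a where "i \<in> {1..s}" "a \<in> {lower i..n i}" "x = prefix i a"
    | i a where "i \<in> {max 2 1..s}" "a \<in> {lower i..n i}" "x = middle i a"
    unfolding star_eq_tail tail_def block_def by blast
  then show "x \<in> grid_vertices s n"
  proof cases
    case 1
    have "v \<le> n j" "u \<le> n j" if "j \<in> {1..s}" for j using n_gt_3[of j] that 1 by auto
    then show ?thesis using 1 by (auto simp: grid_vertices_def head_tuple_def)
  next
    case 2
    have "1 \<le> n j" if "j \<in> {1..s}" for j using n_gt_3[of j] that by auto
    then show ?thesis using 2 by (auto simp: grid_vertices_def head_tuple_def)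
  next
    case 3
    have "1 \<le> n j" if "j \<in> {1..s}" for j using n_gt_3[of j] that by auto
    moreover have "a \<le> n j" if "j \<in> {1..i}" for j
      using n_mono[of j i] that 3 by auto
    moreover have "1 \<le> a" using lower_pos[of i] 3 by auto
    ultimately show ?thesis using 3 by (auto simp: grid_vertices_def prefix_tuple_def)
  next
    case 4
    have "1 \<le> n j" if "j \<in> {1..s}" for j using n_gt_3[of j] that by auto
    moreover have "a \<le> n j" if "j \<in> {1..i}" for j
      using n_mono[of j i] that 4 by auto
    moreover have "1 \<le> a" using lower_pos[of i] 4 by auto
    ultimately show ?thesis using 4 by (auto simp: grid_vertices_def middle_tuple_def)
  qed
qed

end

section \<open>Bi-edges of the star\<close>

locale star_coloring = star_params +
  fixes c :: "tuple \<Rightarrow> nat"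
  assumes bicolored: "bicolored s (star_vertices s n) c"
begin

text \<open>
  All four orientations are needed as rewrite rules: hypotheses equating \<open>n j\<close> with 1 arise in the
  case distinctions of \<open>two_valued\<close>, after the simplifier has turned 1 into \<open>Suc 0\<close>.
\<close>

lemma n_neq_1: "1 \<le> j \<Longrightarrow> j \<le> s \<Longrightarrow> n j \<noteq> 1 \<and> 1 \<noteq> n j \<and> Suc 0 \<noteq> n j \<and> n j \<noteq> Suc 0"
  using n_gt_3[of j] by auto

text \<open>
  The bi-edges of the star that determine a colouring. In each proof the witnesses \<open>i\<close>,
  \<open>j\<close>, \<open>k\<close> are coordinates at which the first and second, second and third, first
  and third tuple differ. As bi-edges are unordered, the same lemma serves to compare any two of its
  tuples with the third one.
\<close>

lemma edge_axis_ones_middle: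
  assumes "a \<in> {2..n 1}" "v \<in> {2..n s}"
  shows "two_valued (c (first_axis a)) (c ones) (c (middle s v))"
proof (rule bicoloredD[OF bicolored])
  show "transversal s (first_axis a) ones (middle s v)"
    by (rule transversalI[where i = 1 and j = 2 and k = 1])
      (use assms s_ge_2 in \<open>auto simp: tuple_defs two_valued_def n_neq_1\<close>)
qed (use assms s_ge_2 in \<open>auto intro!: first_axis_in middle_in X_last_memI(1) simp: lower_def simp del: One_nat_def\<close>)

lemma edge_axis_ones_prefix:
  assumes "1 \<le> m" "m \<le> s" "a \<in> {lower m..n m}" "a \<noteq> 1"
  shows "two_valued (c (first_axis a)) (c ones) (c (prefix m a))"
proof (rule bicoloredD[OF bicolored])
  show "transversal s (first_axis a) ones (prefix m a)"
    by (intro transversalI[where i = 1 and j = 1 and k = 2])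
      (use assms s_ge_2 in \<open>auto simp: tuple_defs two_valued_def n_neq_1\<close>)
  show "first_axis a \<in> star_vertices s n"
    using assms n_mono[of 1 m] lower_pos[of m] by (intro first_axis_in) auto
qed (use assms in \<open>auto intro!: prefix_in X_last_memI(1) simp del: One_nat_def\<close>)

lemma edge_middle_middle_prefix:
  assumes "1 \<le> m" "m < q" "q \<le> s" "a \<in> {lower m..n m}" "k \<in> {lower q..n q}" "k \<noteq> 1" "a \<noteq> k"
  shows "two_valued (c (middle m a)) (c (middle q k)) (c (prefix q k))"
proof (rule bicoloredD[OF bicolored])
  show "transversal s (middle m a) (middle q k) (prefix q k)"
    by (intro transversalI[where i = q and j = 1 and k = 1])
      (use assms s_ge_2 in \<open>auto simp: tuple_defs two_valued_def n_neq_1\<close>)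
qed (use assms in \<open>auto intro!: prefix_in middle_in\<close>)

text \<open>
  The two middle tuples differ only in coordinate \<open>j\<close>, which makes this the bi-edge that lets
  a prefix tuple of an outer layer detect that the colour depends on coordinate \<open>j\<close>. Its
  coordinates before \<open>j\<close> are two-valued because the \<open>n i\<close> with \<open>2 \<le> i < j\<close> all
  differ from \<open>n j\<close>: this uses the strict decrease of \<open>n\<close>.
\<close>

lemma edge_prefix_corner:
  assumes "1 \<le> m" "m < j" "j \<le> s" "a \<in> {lower m..n m}" "a \<noteq> 1" "a \<noteq> n j"
  shows "two_valued (c (prefix m a)) (c (middle j (n j))) (c (middle (j - 1) (n j)))"
proof (rule bicoloredD[OF bicolored])
  obtain j' where j': "j = Suc j'" using assms by (cases j) auto
  have ne: "n i \<noteq> n j" if "2 \<le> i" "i < j" for i using n_strict[of i j] that assms by auto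
  show "transversal s (prefix m a) (middle j (n j)) (middle (j - 1) (n j))"
    by (intro transversalI[where i = 1 and j = j and k = 1])
      (use assms s_ge_2 ne in \<open>auto simp: j' tuple_defs two_valued_def le_Suc_eq n_neq_1\<close>)
  show "middle (j - 1) (n j) \<in> star_vertices s n"
    using assms lower_le[of "j - 1"] by (intro middle_in) (auto simp: lower_def)
qed (use assms lower_le[of j] in \<open>auto intro!: prefix_in middle_in\<close>)

lemma edge_middle_ones_prefix:
  assumes "2 \<le> m" "m \<le> s" "a \<in> {lower m..n m}" "a \<noteq> 1"
  shows "two_valued (c (middle m a)) (c ones) (c (prefix m a))"
proof (rule bicoloredD[OF bicolored])
  show "transversal s (middle m a) ones (prefix m a)"
    by (intro transversalI[where i = 2 and j = 1 and k = 1])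
      (use assms s_ge_2 in \<open>auto simp: tuple_defs two_valued_def n_neq_1\<close>)
qed (use assms in \<open>auto intro!: prefix_in middle_in X_last_memI(1) simp del: One_nat_def\<close>)

lemma edge_two_middles_prefix:
  assumes "2 \<le> m" "m \<le> s" "a \<in> {lower m..n m}" "b \<in> {lower m..n m}" "a \<noteq> b" "a \<noteq> 1"
  shows "two_valued (c (middle m a)) (c (middle m b)) (c (prefix m a))"
proof (rule bicoloredD[OF bicolored])
  show "transversal s (middle m a) (middle m b) (prefix m a)"
    by (intro transversalI[where i = 2 and j = 1 and k = 1])
      (use assms s_ge_2 in \<open>auto simp: tuple_defs two_valued_def n_neq_1\<close>)
qed (use assms in \<open>auto intro!: prefix_in middle_in\<close>)

lemma edge_two_axes_prefix:
  assumes "1 \<le> m" "m \<le> s" "a \<in> {1..n 1}" "b \<in> {lower m..n m}" "a \<noteq> b" "b \<noteq> 1"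
  shows "two_valued (c (first_axis a)) (c (first_axis b)) (c (prefix m b))"
proof (rule bicoloredD[OF bicolored])
  show "transversal s (first_axis a) (first_axis b) (prefix m b)"
    by (intro transversalI[where i = 1 and j = 2 and k = 1])
      (use assms s_ge_2 in \<open>auto simp: tuple_defs two_valued_def n_neq_1\<close>)
  show "first_axis b \<in> star_vertices s n"
    using assms n_mono[of 1 m] lower_pos[of m] by (intro first_axis_in) auto
qed (use assms in \<open>auto intro!: prefix_in first_axis_in simp del: One_nat_def\<close>)

lemma block_coloring:
  "\<exists>f. inj_on f {1..3} \<and>
     ((\<forall>u\<in>{1..3}. \<forall>v\<in>{1..3}. c (head_tuple s u v) = f u) \<or>
      (\<forall>u\<in>{1..3}. \<forall>v\<in>{1..3}. c (head_tuple s u v) = f v))"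
proof -
  have "rectangle_bicolored {1..3} {1..3} (\<lambda>u v. c (head_tuple s u v))"
    unfolding rectangle_bicolored_def
  proof (intro ballI impI)
    fix u u' v v' :: nat
    assume "u \<in> {1..3}" "u' \<in> {1..3}" "v \<in> {1..3}" "v' \<in> {1..3}" "u \<noteq> u'" "v \<noteq> v'"
    moreover from this have "transversal s (head_tuple s u v) (head_tuple s u v') (head_tuple s u' v)"
      by (intro transversalI[where i = 2 and j = 1 and k = 1])
        (use s_ge_2 in \<open>auto simp: tuple_defs two_valued_def n_neq_1\<close>)
    ultimately show "two_valued (c (head_tuple s u v)) (c (head_tuple s u v')) (c (head_tuple s u' v))"
      by (intro bicoloredD[OF bicolored] X_last_memI(1))
  qed
  from rectangle_coloring[OF this three_elements_interval[OF order_refl]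
      three_elements_interval[OF order_refl]]
  show ?thesis by (elim disjE exE conjE) auto
qed

section \<open>Extending a coordinate colouring by one layer\<close>

text \<open>
  The colour is an injective function \<open>f\<close> of coordinate \<open>j\<close>. The range \<open>r\<close> is a
  separate parameter because the first coordinate reaches only \<open>n m\<close> on \<open>tail m\<close>.
\<close>

definition colored_by :: "nat \<Rightarrow> nat \<Rightarrow> tuple set \<Rightarrow> (nat \<Rightarrow> nat) \<Rightarrow> bool" where
  "colored_by j r V f \<longleftrightarrow> inj_on f {1..r} \<and> (\<forall>x\<in>V. x j \<in> {1..r} \<and> c x = f (x j))"

lemma colored_byD:
  assumes "colored_by j r V f" "x \<in> V"
  shows "x j \<in> {1..r}" "c x = f (x j)"
  using assms by (auto simp: colored_by_def)

lemma colored_by_inj: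
  "colored_by j r V f \<Longrightarrow> a \<in> {1..r} \<Longrightarrow> b \<in> {1..r} \<Longrightarrow> f a = f b \<longleftrightarrow> a = b"
  unfolding colored_by_def by (blast dest: inj_onD)

text \<open>
  \<open>tail m\<close> arises from \<open>inner m\<close> by adding axis, prefix and middle tuples with
  values above \<open>bound m\<close> and, for \<open>2 \<le> m < s\<close>, the corner
  \<open>middle m (bound m)\<close>. Starting layer \<open>s\<close> from the \<open>3 \<times> 3\<close> block lets the base of the induction and its step share the
  two extension lemmas below.
\<close>

definition inner :: "nat \<Rightarrow> tuple set" where
  "inner m = (if m = s then block else tail (m + 1))"

definition bound :: "nat \<Rightarrow> nat" where
  "bound m = (if m = s then 3 else n (m + 1))"

lemma bound_facts:
  assumes "1 \<le> m" "m \<le> s"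
  shows "3 \<le> bound m" "bound m \<le> n m" "lower m \<le> bound m" "n m \<le> n 1"
  using assms n_gt_3[of "m + 1"] n_mono[of m "m + 1"] n_s n_mono[of 1 m]
  by (auto simp: bound_def lower_def)

lemma block_memI: "u \<in> {1..3} \<Longrightarrow> v \<in> {1..3} \<Longrightarrow> head_tuple s u v \<in> block"
  by (auto simp: block_def)

lemma block_subset_inner: "block \<subseteq> inner m"
  by (auto simp: inner_def tail_def)

lemma tail_cases:
  assumes "x \<in> tail m" "1 \<le> m" "m \<le> s"
  obtains (inner) "x \<in> inner m"
  | (axis) a where "a \<in> {bound m<..n m}" "x = first_axis a"
  | (prefix) a where "a \<in> {bound m<..n m}" "x = prefix m a"
  | (middle) a where "a \<in> {bound m..n m}" "x = middle m a" "2 \<le> m"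
proof (cases "m = s")
  case True
  from assms(1) consider "x \<in> block" | a where "a \<in> {1..n s}" "x = first_axis a"
    | i a where "i \<in> {m..s}" "a \<in> {lower i..n i}" "x = prefix i a"
    | i a where "i \<in> {max 2 m..s}" "a \<in> {lower i..n i}" "x = middle i a"
    unfolding tail_def True by blast
  then show ?thesis
  proof cases
    case 1
    then show ?thesis using inner True by (simp add: inner_def)
  next
    case 2
    then show ?thesis
      using inner axis[of a] True block_memI[of a 1] by (cases "a \<le> 3") (auto simp: inner_def bound_def)
  next
    case 3
    then show ?thesis
      using inner prefix[of a] True block_memI[of a a]
      by (cases "a \<le> 3") (auto simp: inner_def bound_def lower_def prefix_s)
  next
    case 4
    then show ?thesis
      using inner middle[of a] True block_memI[of 1 a] s_ge_2
      by (cases "a \<le> 3") (auto simp: inner_def bound_def lower_def middle_s)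
  qed
next
  case False
  from assms(1) consider "x \<in> block" | a where "a \<in> {1..n m}" "x = first_axis a"
    | i a where "i \<in> {m..s}" "a \<in> {lower i..n i}" "x = prefix i a"
    | i a where "i \<in> {max 2 m..s}" "a \<in> {lower i..n i}" "x = middle i a"
    unfolding tail_def by blast
  then show ?thesis
  proof cases
    case 1
    then show ?thesis using inner block_subset_inner by blast
  next
    case 2
    then show ?thesis
      using inner axis[of a] False tail_memI(2)[of a "m + 1"]
      by (cases "a \<le> n (m + 1)") (auto simp: inner_def bound_def)
  next
    case 3
    show ?thesis
    proof (cases "i = m \<and> a \<noteq> n (m + 1)")
      case True
      then show ?thesis using 3 prefix[of a] False by (auto simp: bound_def lower_def)
    next
      case not_new: False
      then obtain i' where "i' \<in> {m + 1..s}" "a \<in> {lower i'..n i'}" "x = prefix i' a"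
      proof (cases "i = m")
        case True
        then show ?thesis
          using 3 not_new that[of "m + 1"] prefix_next[of m] lower_le[of "m + 1"] False assms(2,3)
          by auto
      next
        case False
        then show ?thesis using 3 that[of i] by auto
      qed
      then show ?thesis
        using inner tail_memI(3)[of i' "m + 1" a] False by (simp add: inner_def)
    qed
  next
    case 4
    then show ?thesis
      using inner middle[of a] False tail_memI(4)[of i "m + 1" a]
      by (cases "i = m") (auto simp: inner_def bound_def lower_def)
  qed
qed

text \<open>
  For every old value \<open>k\<close> the inner part contains the axis, prefix and middle tuple of
  value \<open>k\<close>, which supply pairs of vertices of equal colour \<open>f k\<close> to
  compare the new vertices with.
\<close>

lemma inner_level:
  assumes "1 \<le> m" "m \<le> s" "k \<in> {1..bound m}"
  obtains q where "m \<le> q" "q \<le> s" "m < q \<or> q = s" "k \<in> {lower q..n q}"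
    "prefix q k \<in> inner m" "first_axis k \<in> inner m" "2 \<le> q \<Longrightarrow> middle q k \<in> inner m"
proof (cases "m = s")
  case True
  then have "k \<in> {1..3}" using assms by (simp add: bound_def)
  then show ?thesis
    using that[of s] True n_s block_memI[of k k] block_memI[of k 1] block_memI[of 1 k]
    by (auto simp: inner_def prefix_s middle_s lower_def)
next
  case False
  then have k: "k \<in> {1..n (m + 1)}" using assms by (simp add: bound_def)
  then obtain q where q: "m + 1 \<le> q" "q \<le> s" "k \<in> {lower q..n q}"
    using level_exists[of "m + 1" k] False assms by auto
  then show ?thesis
    using that[of q] False k tail_memI(2)[of k "m + 1"] tail_memI(3)[of q "m + 1" k]
      tail_memI(4)[of q "m + 1" k]
    by (auto simp: inner_def)
qed

text \<open>
  If the inner part is coloured by coordinate 1, a new axis point differs from each old colour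
  \<open>f k\<close> because it forms a bi-edge with two vertices of that colour. The prefix tuple of the
  same value then has the same new colour.
\<close>

lemma extend_first_coordinate:
  assumes m: "1 \<le> m" "m \<le> s" and f: "colored_by 1 (bound m) (inner m) f"
    and middles: "\<And>a. 2 \<le> m \<Longrightarrow> a \<in> {bound m..n m} \<Longrightarrow> c (middle m a) = f 1"
    and prefixes: "\<And>a. a \<in> {bound m<..n m} \<Longrightarrow> c (prefix m a) \<noteq> f 1"
  shows "\<exists>f. colored_by 1 (n m) (tail m) f"
proof -
  note b = bound_facts[OF m]
  have ones: "c ones = f 1"
    using colored_byD(2)[OF f, of ones] block_memI[of 1 1] block_subset_inner s_ge_2
    by (auto simp: head_tuple_def)
  have last_middle: "c (middle s 2) = f 1"
    using colored_byD(2)[OF f, of "middle s 2"] block_memI[of 1 2] block_subset_inner s_ge_2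
    by (auto simp: middle_s head_tuple_def)
  have new: "c (first_axis a) \<noteq> f k" if a: "a \<in> {bound m<..n m}" and k: "k \<in> {1..bound m}" for a k
  proof (cases "k = 1")
    case True
    then show ?thesis
      using edge_axis_ones_middle[of a 2] a b n_s ones last_middle by (auto simp: two_valued_def)
  next
    case False
    obtain q where q: "m \<le> q" "q \<le> s" "k \<in> {lower q..n q}" "prefix q k \<in> inner m"
      "first_axis k \<in> inner m"
      using inner_level[OF m k] by metis
    have "c (first_axis k) = f k" "c (prefix q k) = f k"
      using colored_byD(2)[OF f q(5)] colored_byD(2)[OF f q(4)] m q s_ge_2
      by (auto simp: tuple_defs)
    then show ?thesis
      using edge_two_axes_prefix[of q a k] a k q m b False by (auto simp: two_valued_def)
  qed
  have prefix_eq: "c (prefix m a) = c (first_axis a)" if a: "a \<in> {bound m<..n m}" for a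
    using edge_axis_ones_prefix[OF m, of a] prefixes[OF a] new[OF a, of 1] ones a b
    by (auto simp: two_valued_def)
  have distinct: "c (first_axis a) \<noteq> c (first_axis a')"
    if a: "a \<in> {bound m<..n m}" "a' \<in> {bound m<..n m}" "a \<noteq> a'" for a a'
    using edge_two_axes_prefix[OF m, of a a'] prefix_eq[OF a(2)] a b by (auto simp: two_valued_def)
  define g where "g a = (if a \<le> bound m then f a else c (first_axis a))" for a
  have "colored_by 1 (n m) (tail m) g"
    unfolding colored_by_def
  proof (intro conjI ballI)
    show "inj_on g {1..n m}"
    proof (rule linorder_inj_onI)
      fix x y assume xy: "x < y" "x \<in> {1..n m}" "y \<in> {1..n m}"
      show "g x \<noteq> g y"
        using xy colored_by_inj[OF f, of x y] new[of y x] distinct[of x y]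
        by (auto simp: g_def)
    qed auto
    fix x assume x: "x \<in> tail m"
    have "x 1 \<in> {1..n m} \<and> c x = g (x 1)"
      using x m
    proof (cases rule: tail_cases)
      case inner
      then show ?thesis using colored_byD[OF f inner] b by (auto simp: g_def)
    next
      case (axis a)
      then show ?thesis using s_ge_2 b by (auto simp: g_def head_tuple_def)
    next
      case (prefix a)
      then show ?thesis using prefix_eq s_ge_2 m b by (auto simp: g_def prefix_tuple_def)
    next
      case (middle a)
      then show ?thesis using middles s_ge_2 m b by (auto simp: g_def middle_tuple_def)
    qed
    then show "x 1 \<in> {1..n m}" "c x = g (x 1)" by auto
  qed
  then show ?thesis by blast
qed

text \<open>
  The bi-edges with \<open>middle s 2\<close> and with \<open>middle s 3\<close> each leave two colours for the
  axis point, and the only common one is that of \<open>ones\<close>.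
\<close>

lemma axis_color:
  assumes "c (middle s 2) \<noteq> c (middle s 3)" "c ones \<noteq> c (middle s 2)" "c ones \<noteq> c (middle s 3)"
    and "a \<in> {2..n 1}"
  shows "c (first_axis a) = c ones"
  using edge_axis_ones_middle[of a 2] edge_axis_ones_middle[of a 3] assms n_s
  by (auto simp: two_valued_def)

lemma axis_color_coordinate:
  assumes f: "colored_by j r V f" and "block \<subseteq> V" and j: "2 \<le> j" "j \<le> s"
    and a: "a \<in> {2..n 1}"
  shows "c ones = f 1" "c (first_axis a) = f 1"
proof -
  have mem: "middle s v \<in> V" if "v \<in> {1..3}" for v
    using block_memI[of 1 v] assms(2) that by (auto simp: middle_s)
  have col: "c (middle s v) = f v \<and> v \<in> {1..r}" if "v \<in> {1..3}" for v
    using colored_byD[OF f mem[OF that]] j by (auto simp: middle_tuple_def)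
  show ones: "c ones = f 1" using col[of 1] by (simp add: middle_s)
  have "f 1 \<noteq> f 2" "f 1 \<noteq> f 3" "f 2 \<noteq> f 3"
    using colored_by_inj[OF f] col[of 1] col[of 2] col[of 3] by auto
  then show "c (first_axis a) = f 1"
    using axis_color[OF _ _ _ a] col[of 2] col[of 3] ones by auto
qed

text \<open>
  The colouring of layer \<open>m\<close> by coordinate \<open>m\<close>, which for \<open>m < s\<close> agrees inside
  with coordinate \<open>m + 1\<close>: new colours appear on the middle and prefix tuples, while the axis points keep the
  colour of the all-ones tuple.
\<close>

lemma extend_new_coordinate:
  assumes m: "2 \<le> m" "m \<le> s" and f: "colored_by m (bound m) (inner m) f"
    and corner: "c (middle m (bound m)) = f (bound m)"
    and middles: "\<And>a k. a \<in> {bound m<..n m} \<Longrightarrow> k \<in> {2..bound m} \<Longrightarrow> c (middle m a) \<noteq> f k"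
    and same: "\<And>a. a \<in> {bound m<..n m} \<Longrightarrow> c (middle m a) = c (prefix m a)"
  shows "\<exists>f. colored_by m (n m) (tail m) f"
proof -
  have m1: "1 \<le> m" using m by simp
  note b = bound_facts[OF m1 m(2)]
  have axis: "c (first_axis a) = f 1" "c ones = f 1" if "a \<in> {bound m<..n m}" for a
    using axis_color_coordinate[OF f block_subset_inner m, of a] that b by auto
  have new: "c (middle m a) \<noteq> f k" if a: "a \<in> {bound m<..n m}" and k: "k \<in> {1..bound m}" for a k
  proof (cases "k = 1")
    case True
    then show ?thesis
      using edge_axis_ones_prefix[OF m1 m(2), of a] axis[OF a] same[OF a] a b
      by (auto simp: two_valued_def)
  next
    case False
    then show ?thesis using middles[of a k] a k by auto
  qed
  have distinct: "c (middle m a) \<noteq> c (middle m a')"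
    if a: "a \<in> {bound m<..n m}" "a' \<in> {bound m<..n m}" "a \<noteq> a'" for a a'
    using edge_two_middles_prefix[OF m, of a a'] same[OF a(1)] a b by (auto simp: two_valued_def)
  define g where "g a = (if a \<le> bound m then f a else c (middle m a))" for a
  have "colored_by m (n m) (tail m) g"
    unfolding colored_by_def
  proof (intro conjI ballI)
    show "inj_on g {1..n m}"
    proof (rule linorder_inj_onI)
      fix x y assume xy: "x < y" "x \<in> {1..n m}" "y \<in> {1..n m}"
      show "g x \<noteq> g y"
        using xy colored_by_inj[OF f, of x y] new[of y x] distinct[of x y]
        by (auto simp: g_def)
    qed auto
    fix x assume x: "x \<in> tail m"
    have "x m \<in> {1..n m} \<and> c x = g (x m)"
      using x m1 m(2)
    proof (cases rule: tail_cases)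
      case inner
      then show ?thesis using colored_byD[OF f inner] b by (auto simp: g_def)
    next
      case (axis a)
      then show ?thesis using \<open>\<And>a. a \<in> _ \<Longrightarrow> c (first_axis a) = f 1\<close> m b
        by (auto simp: g_def head_tuple_def)
    next
      case (prefix a)
      then show ?thesis using same m b by (auto simp: g_def prefix_tuple_def)
    next
      case (middle a)
      then show ?thesis using corner m b by (cases "a = bound m") (auto simp: g_def middle_tuple_def)
    qed
    then show "x m \<in> {1..n m}" "c x = g (x m)" by auto
  qed
  then show ?thesis by blast
qed

text \<open>
  Once the corner of layer \<open>m\<close> has colour \<open>f 1\<close>, the middle tuples follow it, and the
  prefix tuples are forced to the colour \<open>f (n j)\<close>: they differ from \<open>f 1\<close> by the
  bi-edge with an axis point, and \<open>edge_prefix_corner\<close> offers only these two colours.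
\<close>

lemma keep_coordinate:
  assumes m: "1 \<le> m" "m < j" "j \<le> s" and f: "colored_by j (n j) (tail (m + 1)) f"
    and corner: "2 \<le> m \<Longrightarrow> c (middle m (n (m + 1))) = f 1"
  shows "colored_by j (n j) (tail m) f"
proof -
  have ms: "m \<le> s" "m \<noteq> s" using m by auto
  have bnd: "bound m = n (m + 1)" and inn: "inner m = tail (m + 1)"
    using ms by (auto simp: bound_def inner_def)
  note b = bound_facts[OF m(1) ms(1)]
  have lower: "lower m = bound m" using ms by (simp add: bnd lower_def)
  have nj: "3 < n j" "n j \<le> bound m" using n_gt_3[of j] n_mono[of "m + 1" j] m bnd by auto
  have axis: "c (first_axis a) = f 1 \<and> c ones = f 1" if "a \<in> {bound m<..n m}" for a
    using axis_color_coordinate[OF f _ _ m(3), of a] that b m block_subset_inner[of m] inn by auto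
  have col: "c (middle j (n j)) = f (n j)" "c (prefix j (n j)) = f (n j)"
    "c (prefix m (bound m)) = f (n j)"
  proof -
    have "middle j (n j) \<in> tail (m + 1)" "prefix j (n j) \<in> tail (m + 1)"
      using tail_memI(3,4)[of j "m + 1" "n j"] lower_le[of j] m by auto
    then show "c (middle j (n j)) = f (n j)" "c (prefix j (n j)) = f (n j)"
      using colored_byD(2)[OF f] m by (auto simp: tuple_defs)
    have "prefix m (bound m) = prefix (m + 1) (n (m + 1))" using prefix_next[of m] bnd by simp
    moreover have "prefix (m + 1) (n (m + 1)) \<in> tail (m + 1)"
      using tail_memI(3)[of "m + 1" "m + 1" "n (m + 1)"] lower_le[of "m + 1"] m by auto
    ultimately show "c (prefix m (bound m)) = f (n j)"
      using colored_byD(2)[OF f] m by (auto simp: tuple_defs le_Suc_eq)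
  qed
  have ne: "f 1 \<noteq> f (n j)" using colored_by_inj[OF f, of 1 "n j"] nj by auto
  have middles: "c (middle m a) = f 1" if a: "a \<in> {bound m..n m}" and "2 \<le> m" for a
  proof (cases "a = bound m")
    case True
    then show ?thesis using corner that bnd by simp
  next
    case False
    have "two_valued (c (middle m (bound m))) (c (middle m a)) (c (prefix m (bound m)))"
      using edge_two_middles_prefix[OF that(2) ms(1), of "bound m" a] False a b lower by auto
    moreover have "two_valued (c (middle m a)) (c (middle j (n j))) (c (prefix j (n j)))"
      using edge_middle_middle_prefix[OF m, of a "n j"] False a b lower nj lower_le[of j] m by auto
    ultimately show ?thesis
      using corner[OF that(2)] col ne bnd by (auto simp: two_valued_def)
  qed
  have prefixes: "c (prefix m a) = f (n j)" if a: "a \<in> {bound m<..n m}" for a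
  proof -
    have "c (middle (j - 1) (n j)) = f 1"
    proof (cases "j = m + 1")
      case True
      show ?thesis
      proof (cases "m = 1")
        case False
        then show ?thesis using corner m True by simp
      qed (use axis[OF a] True middle_1 in simp)
    next
      case False
      then have "lower (j - 1) = n j" "m + 1 \<le> j - 1" "1 \<le> j - 1" "j - 1 \<le> s"
        using m by (auto simp: lower_def)
      then have "middle (j - 1) (n j) \<in> tail (m + 1)"
        using tail_memI(4)[of "j - 1" "m + 1" "n j"] lower_le[of "j - 1"] m by simp
      then show ?thesis
        using colored_byD(2)[OF f] m by (auto simp: middle_tuple_def)
    qed
    then have "two_valued (c (prefix m a)) (f (n j)) (f 1)"
      using edge_prefix_corner[OF m, of a] a b lower nj col by auto
    moreover have "c (prefix m a) \<noteq> f 1"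
      using edge_axis_ones_prefix[OF m(1) ms(1), of a] axis[OF a] a b lower
      by (auto simp: two_valued_def)
    ultimately show ?thesis using ne by (auto simp: two_valued_def)
  qed
  show ?thesis
    unfolding colored_by_def
  proof (intro conjI ballI)
    show "inj_on f {1..n j}" using f by (simp add: colored_by_def)
    fix x assume x: "x \<in> tail m"
    have "x j \<in> {1..n j} \<and> c x = f (x j)"
      using x m(1) ms(1)
    proof (cases rule: tail_cases)
      case inner
      then show ?thesis using colored_byD[OF f] inn by auto
    next
      case (axis a)
      then show ?thesis using \<open>\<And>a. a \<in> _ \<Longrightarrow> c (first_axis a) = f 1 \<and> _\<close> m nj
        by (auto simp: head_tuple_def)
    next
      case (prefix a)
      then show ?thesis using prefixes m nj by (auto simp: prefix_tuple_def)
    next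
      case (middle a)
      then show ?thesis using middles m nj by (auto simp: middle_tuple_def)
    qed
    then show "x j \<in> {1..n j}" "c x = f (x j)" by auto
  qed
qed

section \<open>Colourings of the star\<close>

text \<open>
  The block is a \<open>3 \<times> 3\<close> rectangle, coloured by its first index, which is coordinate 1, or
  by its second one, which is coordinate \<open>s\<close>.
\<close>

lemma tail_coloring_base:
  "(\<exists>f. colored_by 1 (n s) (tail s) f) \<or> (\<exists>f. colored_by s (n s) (tail s) f)"
proof -
  have s1: "1 \<le> s" using s_ge_2 by simp
  have bnd: "bound s = 3" and inn: "inner s = block" by (auto simp: bound_def inner_def)
  obtain f where inj: "inj_on f {1..3}" and
    "(\<forall>u\<in>{1..3}. \<forall>v\<in>{1..3}. c (head_tuple s u v) = f u) \<or>
     (\<forall>u\<in>{1..3}. \<forall>v\<in>{1..3}. c (head_tuple s u v) = f v)"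
    using block_coloring by blast
  then show ?thesis
  proof (elim disjE)
    assume rows: "\<forall>u\<in>{1..3}. \<forall>v\<in>{1..3}. c (head_tuple s u v) = f u"
    have f: "colored_by 1 3 block f"
      unfolding colored_by_def block_def using inj rows s1 by (auto simp: head_tuple_def)
    have ne: "f 1 \<noteq> f 2" "f 1 \<noteq> f 3" "f 2 \<noteq> f 3"
      using inj by (auto dest!: inj_onD)
    have middles: "c (middle s a) = f 1" if "a \<in> {3..n s}" for a
      using edge_axis_ones_middle[of 2 a] edge_axis_ones_middle[of 3 a] rows ne that
        bound_facts(4)[OF s1] n_s
      by (auto simp: two_valued_def)
    have prefixes: "c (prefix s a) \<noteq> f 1" if "a \<in> {3<..n s}" for a
      using edge_middle_ones_prefix[of s a] s_ge_2 middles[of a] rows that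
      by (auto simp: two_valued_def lower_def)
    have "\<exists>f. colored_by 1 (n s) (tail s) f"
      using extend_first_coordinate[OF s1, of f] f middles prefixes bnd inn by auto
    then show ?thesis ..
  next
    assume cols: "\<forall>u\<in>{1..3}. \<forall>v\<in>{1..3}. c (head_tuple s u v) = f v"
    have f: "colored_by s 3 block f"
      unfolding colored_by_def block_def using inj cols s_ge_2 by (auto simp: head_tuple_def)
    have ones: "c ones = f 1" and axis: "c (first_axis 2) = f 1"
      using cols by auto
    have new: "c (middle s a) \<noteq> f k" if a: "a \<in> {3<..n s}" and k: "k \<in> {1..3}" for a k
    proof (cases "k = 1")
      case True
      then show ?thesis
        using edge_axis_ones_middle[of 2 a] ones axis a bound_facts(4)[OF s1]
        by (auto simp: two_valued_def)
    next
      case False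
      have "c (middle s k) = f k" "c (prefix s k) = f k"
        using cols k by (auto simp: middle_s prefix_s)
      then show ?thesis
        using edge_two_middles_prefix[of s k a] s_ge_2 a k False
        by (auto simp: two_valued_def lower_def)
    qed
    have same: "c (middle s a) = c (prefix s a)" if a: "a \<in> {3<..n s}" for a
    proof -
      have "c (first_axis a) = f 1"
        using axis_color_coordinate[OF f order_refl s_ge_2, of a] a bound_facts(4)[OF s1] by auto
      then have "c (prefix s a) \<noteq> f 1"
        using edge_axis_ones_prefix[of s a] ones s1 a by (auto simp: two_valued_def lower_def)
      then show ?thesis
        using edge_middle_ones_prefix[of s a] new[OF a, of 1] ones s_ge_2 a
        by (auto simp: two_valued_def lower_def)
    qed
    have "c (middle s 3) = f 3" using cols by (simp add: middle_s)
    then have "\<exists>f. colored_by s (n s) (tail s) f"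
      using extend_new_coordinate[OF s_ge_2 order_refl, of f] f new same bnd inn by auto
    then show ?thesis ..
  qed
qed

lemma step_first_coordinate:
  assumes m: "1 \<le> m" "m < s" and f: "colored_by 1 (n (m + 1)) (tail (m + 1)) f"
  shows "\<exists>f. colored_by 1 (n m) (tail m) f"
proof -
  have ms: "m \<le> s" using m by simp
  have bnd: "bound m = n (m + 1)" and inn: "inner m = tail (m + 1)"
    using m by (auto simp: bound_def inner_def)
  note b = bound_facts[OF m(1) ms]
  have lower: "lower m = bound m" using m by (simp add: bnd lower_def)
  have ne: "f 1 \<noteq> f 2" "f 1 \<noteq> f 3" "f 2 \<noteq> f 3"
    using colored_by_inj[OF f] b bnd by auto
  have in_tail: "middle s k \<in> tail (m + 1)" "prefix s k \<in> tail (m + 1)" if "k \<in> {1..3}" for k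
    using tail_memI(1)[of 1 k] tail_memI(1)[of k k] that by (auto simp: middle_s prefix_s)
  have block_col: "c (middle s k) = f 1" "c (prefix s k) = f k" if "k \<in> {1..3}" for k
    using in_tail[OF that, THEN colored_byD(2)[OF f]] s_ge_2 by (auto simp: tuple_defs)
  have ones: "c ones = f 1" using block_col(1)[of 1] by (simp add: middle_s)
  have middles: "c (middle m a) = f 1" if a: "a \<in> {bound m..n m}" for a
  proof -
    have "a > 3" using a bnd n_gt_3[of "m + 1"] m by auto
    then have "two_valued (c (middle m a)) (f 1) (f k)" if "k \<in> {2, 3}" for k
      using edge_middle_middle_prefix[OF m order_refl, of a k] block_col[of k] that a lower n_s
      by (auto simp: lower_def)
    from this[of 2] this[of 3] show ?thesis using ne by (auto simp: two_valued_def)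
  qed
  have corner: "c (middle m (n (m + 1))) = f 1" using middles[of "bound m"] b bnd by auto
  have prefixes: "c (prefix m a) \<noteq> f 1" if a: "a \<in> {bound m<..n m}" for a
  proof -
    have "middle (m + 1) (n (m + 1)) \<in> tail (m + 1)"
      using tail_memI(4)[of "m + 1" "m + 1" "n (m + 1)"] m lower_le[of "m + 1"] by auto
    then have "c (middle (m + 1) (n (m + 1))) = f 1"
      using colored_byD(2)[OF f] m by (auto simp: middle_tuple_def)
    then show ?thesis
      using edge_prefix_corner[of m "m + 1" a] m a b lower bnd corner by (auto simp: two_valued_def)
  qed
  show ?thesis
    using extend_first_coordinate[OF m(1) ms, of f] f bnd inn middles prefixes by simp
qed

text \<open>
  The corner forms a bi-edge with two vertices of colours \<open>f 1\<close> and \<open>f (n j)\<close>, and,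
  as \<open>n j \<noteq> n (m + 1)\<close>, one with two vertices of colour \<open>f (n j)\<close>. For \<open>j = m + 1\<close> the
  second one is missing, and the corner decides between the coordinates \<open>m\<close> and \<open>m + 1\<close>.
\<close>

lemma corner_color:
  assumes m: "2 \<le> m" "m + 1 < j" "j \<le> s" and f: "colored_by j (n j) (tail (m + 1)) f"
  shows "c (middle m (n (m + 1))) = f 1"
proof -
  have lower: "n (m + 1) \<in> {lower m..n m}" using m lower_le[of m] by (auto simp: lower_def)
  have nj: "n j < n (m + 1)" "3 < n j" using n_strict[of "m + 1" j] n_gt_3[of j] m by auto
  have mem: "middle j (n j) \<in> tail (m + 1)" "prefix j (n j) \<in> tail (m + 1)"
    "prefix (m + 1) (n (m + 1)) \<in> tail (m + 1)" "ones \<in> tail (m + 1)"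
    using tail_memI(3,4)[of j "m + 1" "n j"] tail_memI(3)[of "m + 1" "m + 1" "n (m + 1)"]
      tail_memI(1)[of 1 1 "m + 1"] lower_le[of j] lower_le[of "m + 1"] m by auto
  have "c (middle j (n j)) = f (n j)" "c (prefix j (n j)) = f (n j)" "c ones = f 1"
    "c (prefix m (n (m + 1))) = f (n j)"
    using mem[THEN colored_byD(2)[OF f]] m prefix_next[of m] by (auto simp: tuple_defs)
  moreover have "f 1 \<noteq> f (n j)" using colored_by_inj[OF f, of 1 "n j"] nj by auto
  ultimately show ?thesis
    using edge_middle_middle_prefix[of m j "n (m + 1)" "n j"]
      edge_middle_ones_prefix[of m "n (m + 1)"] m lower nj lower_le[of j]
    by (auto simp: two_valued_def)
qed

lemma step_new_coordinate:
  assumes m: "2 \<le> m" "m < s" and f: "colored_by (m + 1) (n (m + 1)) (tail (m + 1)) f"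
    and corner: "c (middle m (n (m + 1))) \<noteq> f 1"
  shows "\<exists>f. colored_by m (n m) (tail m) f"
proof -
  have ms: "1 \<le> m" "m \<le> s" using m by auto
  have bnd: "bound m = n (m + 1)" and inn: "inner m = tail (m + 1)"
    using m by (auto simp: bound_def inner_def)
  note b = bound_facts[OF ms]
  have lower: "lower m = bound m" using m by (simp add: bnd lower_def)
  have equal_coords: "x m = x (m + 1)" if "x \<in> tail (m + 1)" for x
    using that m unfolding tail_def block_def by (auto simp: tuple_defs)
  have f': "colored_by m (bound m) (inner m) f"
    unfolding bnd inn colored_by_def
  proof (intro conjI ballI)
    show "inj_on f {1..n (m + 1)}" using f by (simp add: colored_by_def)
    show "x m \<in> {1..n (m + 1)}" "c x = f (x m)" if "x \<in> tail (m + 1)" for x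
      using colored_byD[OF f that] unfolding equal_coords[OF that] .
  qed
  have ones: "c ones = f 1"
    using axis_color_coordinate(1)[OF f' block_subset_inner m(1) ms(2), of 2] b by auto
  have mid: "middle (m + 1) (n (m + 1)) \<in> tail (m + 1)"
    and pre: "prefix (m + 1) (n (m + 1)) \<in> tail (m + 1)"
    using tail_memI(3,4)[of "m + 1" "m + 1" "n (m + 1)"] m lower_le[of "m + 1"] by auto
  have mid_col: "c (middle (m + 1) (n (m + 1))) = f (bound m)"
    using colored_byD(2)[OF f mid] m bnd by (auto simp: middle_tuple_def)
  have pre_col: "c (prefix m (bound m)) = f (bound m)"
    using colored_byD(2)[OF f pre] m prefix_next[of m] bnd by (auto simp: prefix_tuple_def)
  have "f 1 \<noteq> f (bound m)" using colored_by_inj[OF f', of 1 "bound m"] b by auto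
  then have corner_col: "c (middle m (bound m)) = f (bound m)"
    using edge_middle_ones_prefix[OF m(1) ms(2), of "bound m"] pre_col corner bnd b lower ones
    by (auto simp: two_valued_def)
  have new: "c (middle m a) \<noteq> f k" if a: "a \<in> {bound m<..n m}" and k: "k \<in> {2..bound m}" for a k
  proof -
    obtain q where q: "m \<le> q" "q \<le> s" "m < q \<or> q = s" "k \<in> {lower q..n q}"
      "prefix q k \<in> inner m" "2 \<le> q \<Longrightarrow> middle q k \<in> inner m"
      using inner_level[OF ms, of k] k by auto
    then have "c (middle q k) = f k" "c (prefix q k) = f k"
      using colored_byD(2)[OF f'] m by (auto simp: tuple_defs)
    then show ?thesis
      using edge_middle_middle_prefix[of m q a k] ms m q a k lower by (auto simp: two_valued_def)
  qed
  have same: "c (middle m a) = c (prefix m a)" if a: "a \<in> {bound m<..n m}" for a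
  proof -
    have "two_valued (c (prefix m a)) (f (bound m)) (f (bound m))"
      using edge_prefix_corner[of m "m + 1" a] m a b lower bnd corner_col mid_col by auto
    moreover have "two_valued (c (middle m a)) (f (bound m)) (c (prefix m a))"
      using edge_two_middles_prefix[OF m(1) ms(2), of a "bound m"] a b lower corner_col by auto
    moreover have "c (middle m a) \<noteq> f (bound m)" using new[OF a, of "bound m"] b by auto
    ultimately show ?thesis by (auto simp: two_valued_def)
  qed
  show ?thesis
    by (rule extend_new_coordinate[OF m(1) ms(2) f' corner_col new same])
qed

text \<open>
  Descending from layer \<open>s\<close>, each layer keeps the coordinate of the inner layers, except
  that coordinate \<open>m + 1\<close> may be replaced by \<open>m\<close>: these agree on the inner layers and are
  first told apart by the corner of layer \<open>m\<close>.
\<close>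

lemma tail_coloring:
  "1 \<le> m \<Longrightarrow> m \<le> s \<Longrightarrow>
     (\<exists>f. colored_by 1 (n m) (tail m) f) \<or> (\<exists>j\<in>{m..s}. \<exists>f. colored_by j (n j) (tail m) f)"
proof (induction "s - m" arbitrary: m)
  case 0
  then show ?case using tail_coloring_base by auto
next
  case (Suc d)
  have m: "1 \<le> m" "m < s" using Suc.hyps(2) Suc.prems by auto
  consider f where "colored_by 1 (n (m + 1)) (tail (m + 1)) f"
    | j f where "j \<in> {m + 1..s}" "colored_by j (n j) (tail (m + 1)) f"
  proof -
    have "d = s - (m + 1)" "1 \<le> m + 1" "m + 1 \<le> s" using Suc.hyps(2) m by auto
    from Suc.hyps(1)[OF this] show ?thesis using that by blast
  qed
  then show ?case
  proof cases
    case 1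
    then show ?thesis using step_first_coordinate[OF m] by blast
  next
    case (2 j f)
    show ?thesis
    proof (cases "2 \<le> m \<and> c (middle m (n (m + 1))) \<noteq> f 1")
      case False
      then have "colored_by j (n j) (tail m) f" using keep_coordinate[OF m(1) _ _ 2(2)] 2(1) by auto
      then show ?thesis using 2(1) by auto
    next
      case True
      show ?thesis
      proof (cases "j = m + 1")
        case eq: True
        then show ?thesis using step_new_coordinate[of m f] 2(2) True m by auto
      next
        case False
        then show ?thesis using corner_color[of m j f] 2 m True by auto
      qed
    qed
  qed
qed

end

context star_params
begin

lemma star_coloring_is_coordinate:
  assumes "bicolored s (star_vertices s n) c"
  shows "\<exists>j\<in>{1..s}. \<forall>x\<in>star_vertices s n. \<forall>y\<in>star_vertices s n. c x = c y \<longleftrightarrow> x j = y j"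
proof -
  interpret star_coloring s n c by unfold_locales (rule assms)
  have "1 \<in> {1..s}" "1 \<le> s" using s_ge_2 by auto
  then obtain j f where j: "j \<in> {1..s}" and f: "colored_by j (n j) (tail 1) f"
    using tail_coloring[of 1] by blast
  have "c x = c y \<longleftrightarrow> x j = y j" if "x \<in> tail 1" "y \<in> tail 1" for x y
    using colored_byD[OF f that(1)] colored_byD[OF f that(2)] colored_by_inj[OF f] by metis
  then show ?thesis using j unfolding star_eq_tail by blast
qed

text \<open>
  That all values occur and that the coordinates induce different partitions is seen on star vertices,
  hence it passes to every set of tuples containing the star, in particular to the grid.
\<close>

lemma coordinate_colored_superset:
  assumes V: "star_vertices s n \<subseteq> V" "V \<subseteq> grid_vertices s n"
    and only: "\<And>c. bicolored s V c \<Longrightarrow>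
          \<exists>j\<in>{1..s}. \<forall>x\<in>V. \<forall>y\<in>V. c x = c y \<longleftrightarrow> x j = y j"
  shows "coordinate_colored s n V"
proof
  show "V \<subseteq> grid_vertices s n" by (rule V)
  show "\<exists>j\<in>{1..s}. \<forall>x\<in>V. \<forall>y\<in>V. c x = c y \<longleftrightarrow> x j = y j" if "bicolored s V c" for c
    using only[OF that] .
  show "(\<lambda>x. x j) ` V = {1..n j}" if j: "j \<in> {1..s}" for j
  proof
    show "(\<lambda>x. x j) ` V \<subseteq> {1..n j}"
      using V(2) j by (auto simp: grid_vertices_def PiE_iff dest!: subsetD)
    show "{1..n j} \<subseteq> (\<lambda>x. x j) ` V"
    proof
      fix a assume a: "a \<in> {1..n j}"
      obtain q where q: "j \<le> q" "q \<le> s" "lower q \<le> a" "a \<le> n q"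
        using level_exists[of j a] a j by auto
      then have "prefix q a \<in> V" using prefix_in[of q a] j V(1) by auto
      moreover have "prefix q a j = a" using q j by (auto simp: prefix_tuple_def)
      ultimately show "a \<in> (\<lambda>x. x j) ` V" by (metis rev_image_eqI)
    qed
  qed
  show "\<exists>x\<in>V. \<exists>y\<in>V. x i = y i \<and> x j \<noteq> y j" if ij: "i \<in> {1..s}" "j \<in> {1..s}" "i < j" for i j
  proof (intro bexI conjI)
    show "middle j (n j) i = middle (j - 1) (n j) i" using ij by (auto simp: middle_tuple_def)
    show "middle j (n j) j \<noteq> middle (j - 1) (n j) j"
      using ij n_gt_3[of j] by (auto simp: middle_tuple_def)
    have "lower (j - 1) = n j" using ij by (auto simp: lower_def)
    then show "middle j (n j) \<in> V" "middle (j - 1) (n j) \<in> V"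
      using middle_in[of j "n j"] middle_in[of "j - 1" "n j"] lower_le[of j] lower_le[of "j - 1"]
        ij V(1) by auto
  qed
qed

end

theorem theorem3p2:
  fixes s :: nat and n :: "nat \<Rightarrow> nat"
  assumes "s \<ge> 2"
    and "n 1 \<ge> n 2"
    and "\<And>i. 2 \<le> i \<Longrightarrow> i \<le> s - 1 \<Longrightarrow> n i > n (i + 1)"
    and "n s > 3"
  shows "feasible_set (star_hypergraph s n) = feasible_set (grid_hypergraph s n) \<and>
         chromatic_spectrum (star_hypergraph s n) = chromatic_spectrum (grid_hypergraph s n)"
proof -
  interpret star_params s n using assms by unfold_locales
  have "n i \<ge> 3" if "i \<in> {1..s}" for i using n_gt_3[of i] that by simp
  then have grid: "coordinate_colored s n (grid_vertices s n)"
    using grid_coloring_is_coordinate[OF _ s_ge_2] star_subset_grid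
    by (intro coordinate_colored_superset) auto
  have star: "coordinate_colored s n (star_vertices s n)"
    using star_coloring_is_coordinate star_subset_grid by (intro coordinate_colored_superset) auto
  show ?thesis
    using same_spectrum[OF star grid] by (simp add: star_hypergraph_def derived_sub_grid)
qed

end
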